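(* For every integer $N\ge 1$ there exist an integer $\ell\ge 2$ and a probability weight $(p_i)_{0\le i\le 2\ell-1}$ such that the $L^q$-spectrum $\tau_\mu$ of the associated self-similar measure $\mu$ has at least $N$ points of non-differentiability (phase transitions) in $\mathbb{R}$, and all points of non-differentiability of $\tau_\mu$ are negative.
   Context: For an integer $\ell\ge 2$ and $0\le i\le \ell-1$ define $S_i,S_{i+\ell}:[0,1]\to[0,1]$ by $S_i(x)=\frac{x}{\ell}+\frac{i}{\ell}$ and $S_{i+\ell}(x)=-\frac{x}{\ell}+\frac{i+1}{\ell}$. For a probability weight $(p_i)_{0\le i\le 2\ell-1}$ ($p_i\ge 0$, $\sum_i p_i=1$), the associated self-similar measure $\mu$ is the unique Borel probability measure on $[0,1]$ with $\mu=\sum_{i=0}^{2\ell-1}p_i\,\mu\circ S_i^{-1}$. Only weights with $p_i>0$ for every $0\le i\le \ell-1$ are considered. $\mathcal{F}_n$ is the set of $\ell$-adic intervals $[k/\ell^n,(k+1)/\ell^n)$, $0\le k<\ell^n$, and $\tau_\mu(q)=\limsup_{n\to\infty}\frac{1}{n\log\ell}\log\left(\sum_{I\in\mathcal{F}_n,\,\mu(I)\neq 0}\mu(I)^q\right)$ for $q\in\mathbb{R}$. *)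

theory Defs
  imports "HOL-Probability.Probability"
begin

definition sim_map :: "nat \<Rightarrow> nat \<Rightarrow> real \<Rightarrow> real" where
  "sim_map l i x =
     (if i < l then x / real l + real i / real l
      else - (x / real l) + (real (i - l) + 1) / real l)"

definition admissible_weight :: "nat \<Rightarrow> (nat \<Rightarrow> real) \<Rightarrow> bool" where
  "admissible_weight l p \<longleftrightarrow>
     (\<forall>i<2 * l. p i \<ge> 0) \<and> (\<Sum>i<2 * l. p i) = 1 \<and> (\<forall>i<l. p i > 0)"

text \<open>A Borel probability measure on $[0,1]$ is represented by a Borel probability measure
  on the real line that gives full mass to $[0,1]$.\<close>

definition is_self_similar_measure ::
    "nat \<Rightarrow> (nat \<Rightarrow> real) \<Rightarrow> real measure \<Rightarrow> bool" where
  "is_self_similar_measure l p M \<longleftrightarrow>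
     prob_space M \<and> sets M = sets borel \<and> emeasure M {0..1} = 1 \<and>
     (\<forall>A\<in>sets borel. emeasure M A =
        (\<Sum>i<2 * l. ennreal (p i) * emeasure (distr M borel (sim_map l i)) A))"

text \<open>By Hutchinson's theorem exactly one such measure exists when $l \ge 2$ and the weight
  is admissible.\<close>

definition self_similar_measure :: "nat \<Rightarrow> (nat \<Rightarrow> real) \<Rightarrow> real measure" where
  "self_similar_measure l p = (THE M. is_self_similar_measure l p M)"

definition adic_intervals :: "nat \<Rightarrow> nat \<Rightarrow> real set set" where
  "adic_intervals l n =
     {{real k / real l ^ n ..< (real k + 1) / real l ^ n} | k. k < l ^ n}"

text \<open>For the measures above the upper limit is finite: every interval of level $n$ has mass at
  least $(\min_{i<l} p_i)^n > 0$. So \<^const>\<open>real_of_ereal\<close> loses no information.\<close>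

definition Lq_spectrum :: "nat \<Rightarrow> real measure \<Rightarrow> real \<Rightarrow> real" where
  "Lq_spectrum l M q =
     real_of_ereal (limsup (\<lambda>n. ereal
       (1 / (real n * ln (real l)) *
        ln (\<Sum>I\<in>{I \<in> adic_intervals l n. measure M I \<noteq> 0}. measure M I powr q))))"

definition nondiff_points :: "(real \<Rightarrow> real) \<Rightarrow> real set" where
  "nondiff_points f = {q. \<not> f differentiable (at q)}"

end

theory Submission
  imports Defs
begin

text \<open>
  Reading the digits of an \<open>l\<close>-adic interval from left to right, the masses of the interval and of its
  mirror image under \<open>x \<mapsto> 1 - x\<close> evolve by products of nonnegative two-by-two matrices
  (\<open>adic_mass_Suc\<close>). The weights are chosen such that each of these matrices is either diagonal
  (digits in \<open>D\<close>, with entries in the ratio \<open>1 : 4\<close> or \<open>4 : 1\<close>) or a multiple of the all-one matrix. Splitting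
  an address at its all-one digits gives a renewal equation for the partition sums
  (\<open>moment_renewal\<close>). The initial run of diagonal digits contributes the \<open>q\<close>-th power of one diagonal
  entry and hence the growth rate \<open>\<alpha>(q) = \<beta>(q) (1 + 4\<^sup>q)\<close>, where \<open>\<beta>(q)\<close> is the sum of the \<open>q\<close>-th powers
  of the smaller diagonal entries. Each later run contributes the \<open>q\<close>-th power of the sum of both diagonal
  entries, which is exponentially smaller if \<open>q < 0\<close>. Let \<open>F(q, s)\<close> be the generating function
  of the later runs, which decreases in \<open>s\<close>. The growth rate of the partition sums is \<open>\<alpha>(q)\<close> if
  \<open>F(q, \<alpha>(q)) \<le> 1\<close>, and otherwise the solution \<open>s > \<alpha>(q)\<close> of \<open>F(q, s) = 1\<close> (\<open>excess_le\<close>, \<open>excess_ge\<close>, \<open>excess_nonneg\<close>; \<open>s = \<alpha>(q) exp u\<close>).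

  If \<open>q \<ge> 0\<close>, then \<open>F(q, s)\<close> tends to infinity as \<open>s\<close> decreases to \<open>\<alpha>(q)\<close>. Thus the second case
  holds, and the solution depends differentiably on \<open>q\<close> (\<open>differentiable_nonneg\<close>). At negative \<open>q\<close> both cases
  may occur, and the spectrum is not differentiable where \<open>F(q, \<alpha>(q))\<close> crosses the value \<open>1\<close> with non-zero
  derivative (\<open>not_differentiable\<close>).

  The function \<open>F(q, \<alpha>(q))\<close> is the ratio of the sums of the \<open>q\<close>-th powers of the all-one and of the
  diagonal weights, times a function of \<open>q\<close> alone. Weights of the form \<open>2\<^bsup>-4Lk\<^esup>\<close> with
  multiplicity \<open>2\<^bsup>2L(K\<^sup>2-k\<^sup>2)\<^esup>\<close>, all-one for even and diagonal for odd levels \<open>k \<le> K\<close>, make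
  these sums proportional to sums of the bumps \<open>2\<^bsup>-2L(q+k)\<^sup>2\<^esup>\<close> over the even and over the odd
  \<open>k\<close> (\<open>bump_weights\<close>). For large \<open>L\<close> the sum with the parity of \<open>k\<close> dominates near \<open>q = -k\<close>. Hence the ratio
  crosses \<open>1\<close> between any two consecutive integers, with a logarithmic derivative of order \<open>L\<close> there, which
  makes the crossing transversal.
\<close>

section \<open>Existence of the self-similar measure\<close>

lemma sim_map_measurable [measurable]: "sim_map l i \<in> borel_measurable borel"
proof -
  have "sim_map l i = (\<lambda>x. if i < l then x / real l + real i / real l
      else - (x / real l) + (real (i - l) + 1) / real l)"
    by (auto simp: sim_map_def)
  also have "\<dots> \<in> borel_measurable borel"
    by measurable
  finally show ?thesis .
qed

lemma sim_map_dist: "\<bar>sim_map l i x - sim_map l i y\<bar> = \<bar>x - y\<bar> / real l"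
proof -
  have "sim_map l i x - sim_map l i y = (if i < l then (x - y) / real l else - ((x - y) / real l))"
    by (simp add: sim_map_def diff_divide_distrib)
  then show ?thesis by (simp add: abs_divide)
qed

lemma sim_map_continuous: "isCont (sim_map l i) x"
  by (cases "i < l"; cases "l = 0") (auto simp: sim_map_def[abs_def] intro!: continuous_intros)

lemma sim_map_unit:
  assumes "i < 2 * l" "0 \<le> x" "x \<le> 1"
  shows "0 \<le> sim_map l i x" "sim_map l i x \<le> 1"
proof -
  have l: "real l > 0" using assms(1) by (cases l) auto
  have "i < l \<Longrightarrow> real i + 1 \<le> real l" by linarith
  moreover have "\<not> i < l \<Longrightarrow> real (i - l) + 1 \<le> real l" using assms(1) by linarith
  ultimately show "0 \<le> sim_map l i x" "sim_map l i x \<le> 1" using assms l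
    by (auto simp: sim_map_def add_divide_distrib[symmetric] diff_divide_distrib[symmetric] field_simps)
qed

text \<open>The \<open>n\<close>-th approximation of the point with address \<open>\<omega>\<close>:
  the image of \<open>0\<close> under the first \<open>n\<close> maps of the address.\<close>

primrec code_approx :: "nat \<Rightarrow> nat \<Rightarrow> nat stream \<Rightarrow> real" where
  "code_approx l 0 \<omega> = 0"
| "code_approx l (Suc n) \<omega> = sim_map l (shd \<omega>) (code_approx l n (stl \<omega>))"

text \<open>The point of the unit interval with address \<open>\<omega>\<close>. The limit exists for digits below \<open>2 l\<close>; for
  other streams the value is irrelevant.\<close>

definition code_point :: "nat \<Rightarrow> nat stream \<Rightarrow> real" where
  "code_point l \<omega> = lim (\<lambda>n. code_approx l n \<omega>)"

lemma code_approx_unit: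
  assumes "\<omega> \<in> streams {..<2 * l}"
  shows "0 \<le> code_approx l n \<omega> \<and> code_approx l n \<omega> \<le> 1"
  using assms
proof (induction n arbitrary: \<omega>)
  case (Suc n)
  have "shd \<omega> < 2 * l" "stl \<omega> \<in> streams {..<2 * l}"
    using Suc.prems by (auto elim: streams.cases)
  then show ?case using Suc.IH[of "stl \<omega>"] sim_map_unit by simp
qed simp

lemma code_approx_step:
  assumes "\<omega> \<in> streams {..<2 * l}"
  shows "\<bar>code_approx l (Suc n) \<omega> - code_approx l n \<omega>\<bar> \<le> (1 / real l) ^ n"
  using assms
proof (induction n arbitrary: \<omega>)
  case 0
  show ?case using code_approx_unit[OF 0, of 1] by simp
next
  case (Suc n)
  have "stl \<omega> \<in> streams {..<2 * l}"
    using Suc.prems by (auto elim: streams.cases)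
  from Suc.IH[OF this] show ?case
    by (simp add: sim_map_dist divide_right_mono)
qed

lemma code_approx_LIMSEQ:
  assumes "l \<ge> 2" "\<omega> \<in> streams {..<2 * l}"
  shows "(\<lambda>n. code_approx l n \<omega>) \<longlonglongrightarrow> code_point l \<omega>"
proof -
  have "summable (\<lambda>n. (1 / real l) ^ n)"
    using assms(1) by (intro summable_geometric) auto
  then have "summable (\<lambda>n. code_approx l (Suc n) \<omega> - code_approx l n \<omega>)"
    by (rule summable_comparison_test'[where N=0])
      (use code_approx_step[OF assms(2)] in \<open>simp only: real_norm_def\<close>)
  then have "(\<lambda>n. \<Sum>i<n. code_approx l (Suc i) \<omega> - code_approx l i \<omega>) \<longlonglongrightarrow>
      (\<Sum>i. code_approx l (Suc i) \<omega> - code_approx l i \<omega>)"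
    by (rule summable_LIMSEQ)
  then have "convergent (\<lambda>n. code_approx l n \<omega>)"
    unfolding sum_lessThan_telescope[of "\<lambda>n. code_approx l n \<omega>"] code_approx.simps(1) diff_zero convergent_def by blast
  then show ?thesis
    by (simp add: code_point_def convergent_LIMSEQ_iff)
qed

lemma code_point_unit:
  assumes "l \<ge> 2" "\<omega> \<in> streams {..<2 * l}"
  shows "code_point l \<omega> \<in> {0..1}"
  using LIMSEQ_le_const[OF code_approx_LIMSEQ[OF assms], of 0]
    LIMSEQ_le_const2[OF code_approx_LIMSEQ[OF assms], of 1] code_approx_unit[OF assms(2)]
  by auto

lemma code_point_Stream:
  assumes "l \<ge> 2" "i < 2 * l" "\<omega> \<in> streams {..<2 * l}"
  shows "code_point l (i ## \<omega>) = sim_map l i (code_point l \<omega>)"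
proof -
  have "i ## \<omega> \<in> streams {..<2 * l}" using assms by auto
  from LIMSEQ_Suc[OF code_approx_LIMSEQ[OF assms(1) this]]
  have "(\<lambda>n. sim_map l i (code_approx l n \<omega>)) \<longlonglongrightarrow> code_point l (i ## \<omega>)"
    by simp
  moreover have "(\<lambda>n. sim_map l i (code_approx l n \<omega>)) \<longlonglongrightarrow> sim_map l i (code_point l \<omega>)"
    by (rule isCont_tendsto_compose[OF sim_map_continuous code_approx_LIMSEQ[OF assms(1,3)]])
  ultimately show ?thesis by (rule LIMSEQ_unique)
qed

text \<open>Existence: the law of the point whose address consists of independent digits
  with distribution \<open>p\<close>.\<close>

theorem self_similar_measure_exists:
  assumes l: "l \<ge> 2" and p: "admissible_weight l p"
  shows "\<exists>M. is_self_similar_measure l p M"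
proof -
  define P where "P = point_measure {..<2 * l} (\<lambda>i. ennreal (p i))"
  have nn: "p i \<ge> 0" if "i < 2 * l" for i using p that by (auto simp: admissible_weight_def)
  interpret P: prob_space P
  proof
    have "(\<Sum>i<2 * l. ennreal (p i)) = ennreal (\<Sum>i<2 * l. p i)"
      using nn by (intro sum_ennreal) auto
    also have "\<dots> = 1" using p by (simp add: admissible_weight_def)
    finally show "emeasure P (space P) = 1"
      by (simp add: P_def space_point_measure emeasure_point_measure_finite)
  qed
  define W where "W = stream_space P"
  interpret W: prob_space W unfolding W_def by (rule P.prob_space_stream_space)
  have spW: "space W = streams {..<2 * l}"
    by (simp add: W_def space_stream_space P_def space_point_measure)
  have approx [measurable]: "code_approx l n \<in> borel_measurable W" for n
  proof (induction n)
    case 0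
    have "code_approx l 0 = (\<lambda>_. 0)" by auto
    then show ?case by simp
  next
    case (Suc n)
    have [measurable]: "(\<lambda>\<omega>. shd \<omega>) \<in> measurable W (count_space UNIV)"
    proof -
      have "(\<lambda>\<omega>. shd \<omega>) \<in> measurable W P" unfolding W_def by simp
      moreover have "(\<lambda>x. x) \<in> measurable P (count_space UNIV)" unfolding P_def by simp
      ultimately show ?thesis by (rule measurable_compose)
    qed
    have [measurable]: "(\<lambda>\<omega>. code_approx l n (stl \<omega>)) \<in> borel_measurable W"
      by (rule measurable_compose[OF _ Suc]) (simp add: W_def)
    have "(\<lambda>\<omega>. sim_map l (shd \<omega>) (code_approx l n (stl \<omega>))) \<in> borel_measurable W"
      by (rule measurable_compose_countable[where f="\<lambda>i \<omega>. sim_map l i (code_approx l n (stl \<omega>))"])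
        measurable
    then show ?case by (simp add: fun_eq_iff cong: measurable_cong)
  qed
  have cp [measurable]: "code_point l \<in> borel_measurable W"
    by (rule borel_measurable_LIMSEQ_real[OF _ approx])
      (use code_approx_LIMSEQ[OF l] spW in auto)
  define M where "M = distr W borel (code_point l)"
  have prob: "prob_space M"
    unfolding M_def by (rule W.prob_space_distr) simp
  have one: "emeasure M {0..1} = 1"
  proof -
    have "code_point l -` {0..1} \<inter> space W = space W"
      using code_point_unit[OF l] spW by blast
    then show ?thesis unfolding M_def
      by (subst emeasure_distr) (auto simp: W.emeasure_space_1)
  qed
  have "emeasure M A = (\<Sum>i<2 * l. ennreal (p i) * emeasure (distr M borel (sim_map l i)) A)"
    if A [measurable]: "A \<in> sets borel" for A
  proof -
    have "emeasure M A = (\<integral>\<^sup>+ x. indicator A x \<partial>M)" 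
      by (subst nn_integral_indicator) (auto simp: M_def)
    also have "\<dots> = (\<integral>\<^sup>+ \<omega>. indicator A (code_point l \<omega>) \<partial>W)"
      unfolding M_def by (subst nn_integral_distr) auto
    also have "\<dots> = (\<integral>\<^sup>+ i. \<integral>\<^sup>+ \<omega>. indicator A (code_point l (i ## \<omega>)) \<partial>W \<partial>P)"
      unfolding W_def
    proof (rule P.nn_integral_stream_space)
      have "(\<lambda>\<omega>. indicator A (code_point l \<omega>) :: ennreal) \<in> borel_measurable W" by measurable
      then show "(\<lambda>\<omega>. indicator A (code_point l \<omega>) :: ennreal) \<in> borel_measurable (stream_space P)"
        by (simp add: W_def)
    qed
    also have "\<dots> = (\<Sum>i<2 * l. ennreal (p i) * (\<integral>\<^sup>+ \<omega>. indicator A (code_point l (i ## \<omega>)) \<partial>W))"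
      unfolding P_def by (rule nn_integral_point_measure_finite) simp
    also have "\<dots> = (\<Sum>i<2 * l. ennreal (p i) * emeasure (distr M borel (sim_map l i)) A)"
    proof (intro sum.cong refl arg_cong2[where f="(*)"])
      fix i assume i: "i \<in> {..<2 * l}"
      have "(\<integral>\<^sup>+ \<omega>. indicator A (code_point l (i ## \<omega>)) \<partial>W) =
          (\<integral>\<^sup>+ \<omega>. indicator A (sim_map l i (code_point l \<omega>)) \<partial>W)"
        using i by (intro nn_integral_cong) (simp add: code_point_Stream[OF l] spW)
      also have "\<dots> = (\<integral>\<^sup>+ x. indicator A (sim_map l i x) \<partial>M)"
        unfolding M_def by (subst nn_integral_distr) auto
      also have "\<dots> = (\<integral>\<^sup>+ x. indicator A x \<partial>distr M borel (sim_map l i))"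
        by (subst nn_integral_distr) (auto simp: M_def)
      also have "\<dots> = emeasure (distr M borel (sim_map l i)) A"
        by (subst nn_integral_indicator) auto
      finally show "(\<integral>\<^sup>+ \<omega>. indicator A (code_point l (i ## \<omega>)) \<partial>W) =
          emeasure (distr M borel (sim_map l i)) A" .
    qed
    finally show ?thesis .
  qed
  then have "is_self_similar_measure l p M"
    using prob one by (auto simp: is_self_similar_measure_def M_def)
  then show ?thesis by blast
qed

section \<open>Masses of the adic intervals and uniqueness\<close>

text \<open>A self-similar measure on at least three first-level intervals.\<close>

locale self_similar =
  fixes l :: nat and p :: "nat \<Rightarrow> real" and M :: "real measure"
  assumes l3: "3 \<le> l"
    and adm: "admissible_weight l p"
    and ssm: "is_self_similar_measure l p M"
begin

sublocale real_distribution M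
proof -
  have "prob_space M" "sets M = sets borel"
    using ssm by (auto simp: is_self_similar_measure_def)
  then show "real_distribution M"
    by (intro real_distribution.intro real_distribution_axioms.intro)
qed

lemma p_nonneg: "i < 2 * l \<Longrightarrow> 0 \<le> p i"
  and p_pos: "i < l \<Longrightarrow> 0 < p i"
  using adm by (auto simp: admissible_weight_def)

lemma sum_split: "(\<Sum>i<2 * l. f i) = (\<Sum>i<l. f i + f (i + l))" for f :: "nat \<Rightarrow> real"
proof -
  have "(\<Sum>i<2 * l. f i) = (\<Sum>i<l. f i) + (\<Sum>i\<in>{l..<2 * l}. f i)"
    by (subst sum.union_disjoint[symmetric]) (auto simp: ivl_disj_un)
  also have "(\<Sum>i\<in>{l..<2 * l}. f i) = (\<Sum>i<l. f (i + l))"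
    using sum.shift_bounds_nat_ivl[of f 0 l l] by (simp add: mult_2 atLeast0LessThan)
  finally show ?thesis by (simp add: sum.distrib)
qed

lemma p_sum: "(\<Sum>i<l. p i + p (i + l)) = 1"
  using adm sum_split[of p] by (simp add: admissible_weight_def)

lemma measure_eq:
  assumes "A \<in> sets borel"
  shows "measure M A =
    (\<Sum>i<l. p i * measure M (sim_map l i -` A) + p (i + l) * measure M (sim_map l (i + l) -` A))"
proof -
  have "emeasure M A = (\<Sum>i<2 * l. ennreal (p i) * emeasure (distr M borel (sim_map l i)) A)"
    using ssm assms unfolding is_self_similar_measure_def by blast
  also have "\<dots> = (\<Sum>i<2 * l. ennreal (p i * measure M (sim_map l i -` A)))"
  proof (intro sum.cong refl)
    fix i assume "i \<in> {..<2 * l}"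
    have "emeasure (distr M borel (sim_map l i)) A = emeasure M (sim_map l i -` A)"
      using assms by (subst emeasure_distr) auto
    then show "ennreal (p i) * emeasure (distr M borel (sim_map l i)) A =
        ennreal (p i * measure M (sim_map l i -` A))"
      using p_nonneg[of i] \<open>i \<in> _\<close> by (simp add: emeasure_eq_measure ennreal_mult)
  qed
  also have "\<dots> = ennreal (\<Sum>i<2 * l. p i * measure M (sim_map l i -` A))"
    using p_nonneg by (intro sum_ennreal) auto
  finally have "ennreal (measure M A) = ennreal (\<Sum>i<2 * l. p i * measure M (sim_map l i -` A))"
    by (simp add: emeasure_eq_measure)
  moreover have "0 \<le> (\<Sum>i<2 * l. p i * measure M (sim_map l i -` A))"
    using p_nonneg by (intro sum_nonneg) auto
  ultimately have "measure M A = (\<Sum>i<2 * l. p i * measure M (sim_map l i -` A))"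
    by (simp only: ennreal_inj measure_nonneg)
  then show ?thesis by (simp add: sum_split)
qed

lemma unit_interval: "measure M {0..1} = 1"
  using ssm by (simp add: is_self_similar_measure_def emeasure_eq_measure)

lemma measure_outside:
  assumes "A \<in> sets borel" "A \<inter> {0..1} = {}"
  shows "measure M A = 0"
proof -
  have "measure M (A \<union> {0..1}) = measure M A + measure M {0..1}"
    using assms by (intro finite_measure_Union) auto
  with prob_le_1[of "A \<union> {0..1}"] show ?thesis
    using unit_interval measure_nonneg[of M A] by linarith
qed

lemma map_eq: "i < l \<Longrightarrow> sim_map l i x = (x + real i) / real l"
  and reflected_eq: "sim_map l (i + l) x = (real i + 1 - x) / real l"
  by (simp_all add: sim_map_def add_divide_distrib diff_divide_distrib)

lemma vimage_map: "i < l \<Longrightarrow> sim_map l i x = y \<longleftrightarrow> x = real l * y - real i"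
  and vimage_reflected: "sim_map l (i + l) x = y \<longleftrightarrow> x = real i + 1 - real l * y"
  using l3 by (auto simp: map_eq reflected_eq field_simps)

text \<open>Three maps suffice for non-atomicity: a point lies in at most two of the first-level
  intervals, so the mass of an atom would be at most \<open>1 - min p\<close> times the supremum of the
  masses of all atoms.\<close>

lemma no_atom: "measure M {x} = 0"
proof -
  define s where "s = (SUP x. measure M {x})"
  have bdd: "bdd_above (range (\<lambda>x. measure M {x}))"
    by (rule bdd_aboveI[of _ 1]) auto
  have le_s: "measure M {x} \<le> s" for x
    unfolding s_def by (rule cSUP_upper[OF _ bdd]) simp
  define c where "c = Min (p ` {..<l})"
  have c_le: "c \<le> p i" if "i < l" for i
    unfolding c_def using that by (intro Min_le) auto
  have c: "c > 0"
    unfolding c_def using l3 p_pos by (subst Min_gr_iff) (auto simp: lessThan_empty_iff)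
  have s0: "s \<ge> 0" using le_s[of 0] measure_nonneg[of M "{0}"] by linarith
  have bound: "measure M {x} \<le> (1 - c) * s" for x
  proof -
    \<comment> \<open>An index whose interval \<open>[i0 / l, (i0 + 1) / l]\<close> misses \<open>x\<close>.\<close>
    define i0 :: nat where "i0 = (if real l * x < 2 then 2 else 0)"
    have i0: "i0 < l" using l3 by (simp add: i0_def)
    have out: "measure M {real l * x - real i0} = 0"
      by (rule measure_outside) (auto simp: i0_def)
    have "measure M {x} =
      (\<Sum>i<l. p i * measure M {real l * x - real i} + p (i + l) * measure M {real i + 1 - real l * x})"
    proof -
      have "sim_map l i -` {x} = {real l * x - real i}" if "i < l" for i
        using vimage_map[OF that] by auto
      moreover have "sim_map l (i + l) -` {x} = {real i + 1 - real l * x}" for i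
        using vimage_reflected by auto
      ultimately show ?thesis by (subst measure_eq) auto
    qed
    also have "\<dots> \<le> (\<Sum>i<l. (p i + p (i + l)) * s - (if i = i0 then p i * s else 0))"
    proof (rule sum_mono)
      fix i assume "i \<in> {..<l}"
      then have i: "i < l" by simp
      have r: "p (i + l) * measure M {real i + 1 - real l * x} \<le> p (i + l) * s"
        using i p_nonneg[of "i + l"] le_s by (intro mult_left_mono) auto
      have "p i * measure M {real l * x - real i} \<le> (if i = i0 then 0 else p i * s)"
        using out p_pos[OF i] le_s by (auto intro: mult_left_mono)
      with r show "p i * measure M {real l * x - real i} + p (i + l) * measure M {real i + 1 - real l * x}
          \<le> (p i + p (i + l)) * s - (if i = i0 then p i * s else 0)"
        by (auto simp: algebra_simps)
    qed
    also have "\<dots> = (1 - p i0) * s"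
      using i0 by (simp add: sum_subtractf sum_distrib_right[symmetric] p_sum left_diff_distrib)
    also have "\<dots> \<le> (1 - c) * s"
      using c_le[OF i0] s0 by (intro mult_right_mono) auto
    finally show ?thesis .
  qed
  have "s \<le> (1 - c) * s"
    unfolding s_def by (rule cSUP_least) (use bound in \<open>auto simp: s_def\<close>)
  then have "c * s \<le> 0" by (simp add: algebra_simps)
  then have "s \<le> 0" using c by (simp add: mult_le_0_iff)
  then show ?thesis using le_s[of x] measure_nonneg[of M "{x}"] by linarith
qed

lemma measure_outside_open:
  assumes "A \<in> sets borel" "A \<inter> {0<..<1} = {}"
  shows "measure M A = 0"
proof -
  have "x \<in> {0, 1}" if "x \<in> A" "0 \<le> x" "x \<le> 1" for x
    using assms(2) that by (auto simp: less_le)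
  then have "A \<subseteq> (A - {0..1}) \<union> ({0} \<union> {1})"
    by (auto simp del: atLeastAtMost_iff) (metis atLeastAtMost_iff insertE singletonD)
  then have "measure M A \<le> measure M ((A - {0..1}) \<union> ({0} \<union> {1}))"
    using assms(1) by (intro finite_measure_mono) auto
  also have "\<dots> \<le> measure M (A - {0..1}) + (measure M {0} + measure M {1})"
    using assms by (intro order_trans[OF measure_subadditive] add_left_mono measure_subadditive) auto
  also have "\<dots> = 0"
    using assms by (subst measure_outside) (auto simp: no_atom)
  finally show ?thesis using measure_nonneg[of M A] by linarith
qed

lemma measure_half_open:
  assumes "a \<le> b"
  shows "measure M {a<..b} = measure M {a..<b}"
proof (cases "a = b")
  case False
  then have "a < b" using assms by simp
  have "measure M {a<..b} = measure M ({a<..<b} \<union> {b})"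
    using \<open>a < b\<close> by (intro arg_cong[where f="measure M"]) auto
  also have "\<dots> = measure M {a<..<b} + measure M {b}"
    by (rule finite_measure_Union) auto
  also have "\<dots> = measure M {a} + measure M {a<..<b}"
    by (simp add: no_atom)
  also have "\<dots> = measure M ({a} \<union> {a<..<b})"
    by (rule finite_measure_Union[symmetric]) auto
  also have "{a} \<union> {a<..<b} = {a..<b}" using \<open>a < b\<close> by auto
  finally show ?thesis .
qed simp

text \<open>The mass of the \<open>k\<close>-th interval of level \<open>n\<close>, counted from the left, starting with \<open>0\<close>.\<close>

definition adic_mass :: "nat \<Rightarrow> nat \<Rightarrow> real" where
  "adic_mass n k = measure M {real k / real l ^ n ..< (real k + 1) / real l ^ n}"

lemma adic_mass_0: "adic_mass 0 0 = 1"
proof -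
  have "measure M ({0..<1} \<union> {1}) = measure M {0..<1} + measure M {1}"
    by (rule finite_measure_Union) auto
  moreover have "{0..<1} \<union> {1::real} = {0..1}" by auto
  ultimately show ?thesis by (simp add: adic_mass_def no_atom unit_interval)
qed

text \<open>Only the two maps onto the interval with first digit \<open>j\<close> contribute, and the reversing
  one turns the index \<open>k\<close> into \<open>l ^ n - 1 - k\<close>.\<close>

lemma adic_mass_Suc:
  assumes j: "j < l" and k: "k < l ^ n"
  shows "adic_mass (Suc n) (j * l ^ n + k) =
    p j * adic_mass n k + p (j + l) * adic_mass n (l ^ n - 1 - k)"
proof -
  define L where "L = real l"
  have L: "L > 0" using l3 by (simp add: L_def)
  define B where "B = L ^ n"
  have B: "B > 0" using L by (simp add: B_def)
  have kB: "real k + 1 \<le> B"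
  proof -
    have "real (k + 1) \<le> real (l ^ n)" using k by (subst of_nat_le_iff) simp
    then show ?thesis by (simp add: B_def L_def)
  qed
  define I where "I = {real (j * l ^ n + k) / real l ^ Suc n ..< (real (j * l ^ n + k) + 1) / real l ^ Suc n}"
  have I: "I = {(real j + real k / B) / L ..< (real j + (real k + 1) / B) / L}"
    using L B unfolding I_def L_def[symmetric] B_def
    by (simp add: L_def[symmetric] field_simps)
  have v1: "sim_map l i -` I = {real k / B + real j - real i ..< (real k + 1) / B + real j - real i}"
    if "i < l" for i
    using L by (auto simp: I map_eq[OF that] L_def[symmetric] divide_le_cancel divide_less_cancel)
  have v2: "sim_map l (i + l) -` I =
      {real i + 1 - real j - (real k + 1) / B <.. real i + 1 - real j - real k / B}" for i
    using L by (auto simp: I reflected_eq L_def[symmetric] divide_le_cancel divide_less_cancel)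
  have frac: "0 \<le> real k / B" "(real k + 1) / B \<le> 1" using B kB by auto
  have z1: "measure M (sim_map l i -` I) = 0" if "i < l" "i \<noteq> j" for i
  proof (rule measure_outside_open)
    have "real i + 1 \<le> real j \<or> real j + 1 \<le> real i" using that by linarith
    then show "sim_map l i -` I \<inter> {0<..<1} = {}"
      unfolding v1[OF that(1)] using frac by auto
  qed (simp add: v1[OF that(1)])
  have z2: "measure M (sim_map l (i + l) -` I) = 0" if "i < l" "i \<noteq> j" for i
  proof (rule measure_outside_open)
    have "real i + 1 \<le> real j \<or> real j + 1 \<le> real i" using that by linarith
    then show "sim_map l (i + l) -` I \<inter> {0<..<1} = {}"
      unfolding v2 using frac by auto
  qed (simp add: v2)
  have e1: "measure M (sim_map l j -` I) = adic_mass n k"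
    by (simp add: v1[OF j] adic_mass_def B_def L_def)
  have e2: "measure M (sim_map l (j + l) -` I) = adic_mass n (l ^ n - 1 - k)"
  proof -
    have "real (l ^ n - 1 - k) = B - 1 - real k"
      using k by (simp add: B_def L_def of_nat_diff)
    then have "adic_mass n (l ^ n - 1 - k) = measure M {(B - 1 - real k) / B ..< (B - 1 - real k + 1) / B}"
      by (simp add: adic_mass_def B_def L_def)
    also have "\<dots> = measure M {1 - (real k + 1) / B ..< 1 - real k / B}"
      using B by (intro arg_cong[where f="measure M"]) (auto simp: field_simps)
    also have "\<dots> = measure M {1 - (real k + 1) / B <.. 1 - real k / B}"
      using B by (intro measure_half_open[symmetric]) (auto simp: field_simps)
    finally show ?thesis unfolding v2 by simp
  qed
  have "adic_mass (Suc n) (j * l ^ n + k) = measure M I"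
    by (simp add: adic_mass_def I_def)
  also have "\<dots> = (\<Sum>i<l. p i * measure M (sim_map l i -` I) + p (i + l) * measure M (sim_map l (i + l) -` I))"
    by (rule measure_eq) (simp add: I_def)
  also have "\<dots> = (\<Sum>i<l. if i = j then p j * adic_mass n k + p (j + l) * adic_mass n (l ^ n - 1 - k) else 0)"
    using z1 z2 e1 e2 by (intro sum.cong) auto
  also have "\<dots> = p j * adic_mass n k + p (j + l) * adic_mass n (l ^ n - 1 - k)"
    using j by simp
  finally show ?thesis .
qed

lemma cdf_adic:
  "cdf M (real K / real l ^ n) = (\<Sum>k<K. adic_mass n k)"
proof (induction K)
  case 0
  have "cdf M 0 = 0"
    unfolding cdf_def by (rule measure_outside_open) auto
  then show ?case by simp
next
  case (Suc K)
  have le: "real K / real l ^ n \<le> (real K + 1) / real l ^ n"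
    by (simp add: divide_right_mono)
  have "cdf M ((real K + 1) / real l ^ n) = cdf M (real K / real l ^ n) +
      measure M {real K / real l ^ n <.. (real K + 1) / real l ^ n}"
  proof -
    have "measure M ({..real K / real l ^ n} \<union> {real K / real l ^ n <.. (real K + 1) / real l ^ n}) =
      measure M {..real K / real l ^ n} + measure M {real K / real l ^ n <.. (real K + 1) / real l ^ n}"
      by (rule finite_measure_Union) auto
    with le show ?thesis by (simp add: cdf_def ivl_disj_un)
  qed
  then show ?case
    using Suc le by (simp add: measure_half_open adic_mass_def add.commute)
qed

end

lemma adic_mass_unique:
  assumes "self_similar l p M" "self_similar l p M'" "k < l ^ n"
  shows "self_similar.adic_mass l M n k = self_similar.adic_mass l M' n k"
  using assms(3)
proof (induction n arbitrary: k)
  case 0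
  then show ?case using assms by (simp add: self_similar.adic_mass_0)
next
  case (Suc n)
  have l: "l > 0" using self_similar.l3[OF assms(1)] by simp
  define j where "j = k div l ^ n"
  define r where "r = k mod l ^ n"
  have k: "k = j * l ^ n + r" unfolding j_def r_def by (rule div_mult_mod_eq[symmetric])
  have r: "r < l ^ n" using l by (simp add: r_def)
  have j: "j < l" using Suc.prems by (simp add: j_def less_mult_imp_div_less mult.commute)
  have "l ^ n - 1 - r < l ^ n" using r by simp
  then show ?case
    using self_similar.adic_mass_Suc[OF assms(1) j r] self_similar.adic_mass_Suc[OF assms(2) j r]
      Suc.IH[OF r] Suc.IH[of "l ^ n - 1 - r"] k by simp
qed

text \<open>The masses of the adic intervals determine the distribution function at the adic points, and
  by right-continuity everywhere.\<close>

lemma self_similar_unique: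
  assumes M: "self_similar l p M" and M': "self_similar l p M'"
  shows "M = M'"
proof -
  interpret M: self_similar l p M by (rule M)
  interpret M': self_similar l p M' by (rule M')
  have l1: "real l > 1" using M.l3 by simp
  have "cdf M x = cdf M' x" for x
  proof -
    consider "x < 0" | "1 \<le> x" | "0 \<le> x" "x < 1" by linarith
    then show ?thesis
    proof cases
      case 1
      then show ?thesis unfolding cdf_def
        by (subst M.measure_outside_open, simp, force)
          (subst M'.measure_outside_open, simp, force, simp)
    next
      case 2
      have "measure M {0..1} \<le> cdf M x" "measure M' {0..1} \<le> cdf M' x"
        unfolding cdf_def using 2
        by (auto intro!: M.finite_measure_mono M'.finite_measure_mono)
      then show ?thesis
        using M.cdf_bounded_prob[of x] M'.cdf_bounded_prob[of x] M.unit_interval M'.unit_interval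
        by linarith
    next
      case 3
      define K where "K n = nat \<lfloor>x * real l ^ n\<rfloor> + 1" for n
      define y where "y n = real (K n) / real l ^ n" for n
      have K: "x * real l ^ n < real (K n)" "real (K n) \<le> x * real l ^ n + 1" for n
        unfolding K_def using 3 by (auto simp: add.commute) linarith+
      have "K n \<le> l ^ n" for n
      proof -
        have "x * real l ^ n < real l ^ n" using 3 l1 by simp
        then have "real (K n) < real l ^ n + 1" using K(2)[of n] by linarith
        also have "\<dots> = real (l ^ n + 1)" by simp
        finally show ?thesis by (subst (asm) of_nat_less_iff) simp
      qed
      then have eq: "cdf M (y n) = cdf M' (y n)" for n
        unfolding y_def M.cdf_adic M'.cdf_adic
        by (intro sum.cong refl adic_mass_unique[OF M M']) (auto intro: less_le_trans)
      have y: "x < y n" "y n \<le> x + (1 / real l) ^ n" for n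
        using K[of n] l1 by (auto simp: y_def field_simps power_one_over)
      have "(\<lambda>n. x + (1 / real l) ^ n) \<longlonglongrightarrow> x + 0"
        using l1 by (intro tendsto_add tendsto_const LIMSEQ_power_zero) auto
      then have "y \<longlonglongrightarrow> x"
        using y by (intro tendsto_sandwich[of "\<lambda>_. x" y sequentially "\<lambda>n. x + (1 / real l) ^ n" x])
          (auto intro: less_imp_le always_eventually)
      then have lim: "filterlim y (at_right x) sequentially"
        using y(1) by (auto simp: filterlim_at less_imp_neq[THEN not_sym])
      have "(\<lambda>n. cdf M (y n)) \<longlonglongrightarrow> cdf M x"
        using M.cdf_is_right_cont[of x] lim unfolding continuous_within
        by (rule filterlim_compose)
      moreover have "(\<lambda>n. cdf M' (y n)) \<longlonglongrightarrow> cdf M' x"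
        using M'.cdf_is_right_cont[of x] lim unfolding continuous_within
        by (rule filterlim_compose)
      ultimately show ?thesis unfolding eq by (rule LIMSEQ_unique)
    qed
  qed
  then show ?thesis
    using M.real_distribution_axioms M'.real_distribution_axioms by (intro cdf_unique) auto
qed

theorem self_similar_measure:
  assumes "3 \<le> l" "admissible_weight l p"
  shows "self_similar l p (self_similar_measure l p)"
proof -
  have "\<exists>M. is_self_similar_measure l p M"
    using assms by (intro self_similar_measure_exists) auto
  moreover have "M = M'" if "is_self_similar_measure l p M" "is_self_similar_measure l p M'" for M M'
    using self_similar_unique[of l p M M'] assms that by (auto simp: self_similar_def)
  ultimately have "\<exists>!M. is_self_similar_measure l p M" by blast
  then have "is_self_similar_measure l p (self_similar_measure l p)"
    unfolding self_similar_measure_def by (rule theI')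
  with assms show ?thesis by (simp add: self_similar_def)
qed

section \<open>Weights with mirror-symmetric pairs of digits\<close>

text \<open>\<open>pair_sum q n x y\<close> adds up \<open>(u + v) powr q\<close> over the \<open>2 ^ n\<close> pairs \<open>(u, v)\<close> that
  arise from \<open>(x, y)\<close> by \<open>n\<close> times multiplying one of the two components by \<open>4\<close>.\<close>

primrec pair_sum :: "real \<Rightarrow> nat \<Rightarrow> real \<Rightarrow> real \<Rightarrow> real" where
  "pair_sum q 0 x y = (x + y) powr q"
| "pair_sum q (Suc n) x y = pair_sum q n (4 * x) y + pair_sum q n x (4 * y)"

lemma pair_sum_pos: "0 < x \<Longrightarrow> 0 \<le> y \<Longrightarrow> 0 < pair_sum q n x y"
  by (induction n arbitrary: x y) (auto intro!: add_pos_pos)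

lemma pair_sum_single: "0 < x \<Longrightarrow> pair_sum q n x 0 = x powr q * (1 + 4 powr q) ^ n"
  by (induction n arbitrary: x) (auto simp: powr_mult algebra_simps)

text \<open>There are \<open>2 m\<close> digits; digit \<open>j < m\<close> is paired with its mirror image \<open>2 m - 1 - j\<close>. A pair in
  \<open>D\<close> has the weights \<open>a j\<close> and \<open>4 * a j\<close> and no orientation-reversing maps; a pair outside \<open>D\<close>
  has the weight \<open>a j\<close> on each of its four maps. Writing the masses of an interval and of its mirror
  image as a vector, a digit in \<open>D\<close> acts by the diagonal matrix with entries \<open>a j\<close>, \<open>4 * a j\<close> or
  its mirror image, a digit outside \<open>D\<close> by \<open>a j\<close> times the all-one matrix.\<close>

locale paired_weights =
  fixes m :: nat and D :: "nat set" and a :: "nat \<Rightarrow> real"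
  assumes m2: "2 \<le> m"
    and a_pos: "\<And>j. j < m \<Longrightarrow> 0 < a j"
    and total: "(\<Sum>j<m. if j \<in> D then 5 * a j else 4 * a j) = 1"
    and D_ex: "\<exists>j<m. j \<in> D"
    and D_ex': "\<exists>j<m. j \<notin> D"
begin

text \<open>Indices from \<open>2 * m\<close> on belong to the orientation-reversing maps.\<close>

definition weight :: "nat \<Rightarrow> real" where
  "weight i =
    (if i < m then a i
     else if i < 2 * m then (if 2 * m - 1 - i \<in> D then 4 else 1) * a (2 * m - 1 - i)
     else let j = (if i - 2 * m < m then i - 2 * m else 2 * m - 1 - (i - 2 * m))
       in if j \<in> D then 0 else a j)"

text \<open>Sums of the \<open>q\<close>-th powers of \<open>a j\<close> over the pairs in \<open>D\<close>, and over the digits outside \<open>D\<close>, where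
  both digits of a pair count, whence the factor \<open>2\<close>.\<close>

definition diag_sum :: "real \<Rightarrow> real" where
  "diag_sum q = (\<Sum>j<m. if j \<in> D then a j powr q else 0)"

definition full_sum :: "real \<Rightarrow> real" where
  "full_sum q = (\<Sum>j<m. if j \<in> D then 0 else 2 * a j powr q)"

lemma diag_sum_pos: "0 < diag_sum q"
proof -
  obtain j where "j < m" "j \<in> D" using D_ex by blast
  then show ?thesis unfolding diag_sum_def
    using a_pos[of j] by (intro sum_pos2[of _ j]) auto
qed

lemma full_sum_pos: "0 < full_sum q"
proof -
  obtain j where "j < m" "j \<notin> D" using D_ex' by blast
  then show ?thesis unfolding full_sum_def
    using a_pos[of j] by (intro sum_pos2[of _ j]) auto
qed

lemma sum_paired: "(\<Sum>j<2 * m. g j) = (\<Sum>j<m. g j + g (2 * m - 1 - j))" for g :: "nat \<Rightarrow> real"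
proof -
  have "(\<Sum>j<2 * m. g j) = (\<Sum>j<m. g j) + (\<Sum>j\<in>{m..<2 * m}. g j)"
    by (subst sum.union_disjoint[symmetric]) (auto simp: ivl_disj_un)
  also have "(\<Sum>j\<in>{m..<2 * m}. g j) = (\<Sum>j<m. g (2 * m - 1 - j))"
    by (rule sum.reindex_bij_witness[of _ "\<lambda>j. 2 * m - 1 - j" "\<lambda>j. 2 * m - 1 - j"]) auto
  finally show ?thesis by (simp add: sum.distrib)
qed

lemma weight_simps:
  assumes "j < m"
  shows "weight j = a j" "weight (2 * m - 1 - j) = (if j \<in> D then 4 else 1) * a j"
    "weight (j + 2 * m) = (if j \<in> D then 0 else a j)"
    "weight (2 * m - 1 - j + 2 * m) = (if j \<in> D then 0 else a j)"
proof -
  have *: "\<not> 2 * m - 1 - j < m" "2 * m - 1 - j < 2 * m" "2 * m - 1 - (2 * m - 1 - j) = j"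
    "\<not> j + 2 * m < m" "\<not> j + 2 * m < 2 * m" "j + 2 * m - 2 * m = j"
    "\<not> 2 * m - 1 - j + 2 * m < m" "\<not> 2 * m - 1 - j + 2 * m < 2 * m"
    "2 * m - 1 - j + 2 * m - 2 * m = 2 * m - 1 - j"
    using assms by auto
  show "weight j = a j" "weight (2 * m - 1 - j) = (if j \<in> D then 4 else 1) * a j"
    "weight (j + 2 * m) = (if j \<in> D then 0 else a j)"
    "weight (2 * m - 1 - j + 2 * m) = (if j \<in> D then 0 else a j)"
    unfolding weight_def Let_def by (simp_all only: * assms if_True if_False)
qed

lemma less_double_cases:
  assumes "i < 2 * m"
  obtains "i < m" | j where "j < m" "i = 2 * m - 1 - j"
proof (cases "i < m")
  case False
  then have "2 * m - 1 - i < m" "i = 2 * m - 1 - (2 * m - 1 - i)" using assms by auto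
  then show ?thesis using that by blast
qed (use that in blast)

lemma admissible: "admissible_weight (2 * m) weight"
proof -
  have pos: "0 < weight i" if "i < 2 * m" for i
    using that
  proof (cases rule: less_double_cases)
    case (2 j)
    show ?thesis unfolding 2(2) weight_simps[OF 2(1)] using a_pos[OF 2(1)] by simp
  qed (simp add: weight_simps a_pos)
  have nonneg: "0 \<le> weight (i + 2 * m)" if "i < 2 * m" for i
    using that
  proof (cases rule: less_double_cases)
    case (2 j)
    show ?thesis unfolding 2(2) weight_simps[OF 2(1)] using a_pos[OF 2(1)] by simp
  qed (simp add: weight_simps less_imp_le[OF a_pos])
  have "0 \<le> weight i" if "i < 2 * (2 * m)" for i
  proof (cases "i < 2 * m")
    case False
    then show ?thesis using nonneg[of "i - 2 * m"] that by simp
  qed (use pos in \<open>simp add: less_imp_le\<close>)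
  moreover have "(\<Sum>i<2 * (2 * m). weight i) = 1"
  proof -
    have "(\<Sum>i<2 * (2 * m). weight i) = (\<Sum>i<2 * m. weight i) + (\<Sum>i\<in>{2 * m..<2 * m + 2 * m}. weight i)"
      by (subst sum.union_disjoint[symmetric]) (auto simp: ivl_disj_un)
    also have "(\<Sum>i\<in>{2 * m..<2 * m + 2 * m}. weight i) = (\<Sum>i<2 * m. weight (i + 2 * m))"
      using sum.shift_bounds_nat_ivl[of weight 0 "2 * m" "2 * m"] by (simp add: atLeast0LessThan)
    finally have "(\<Sum>i<2 * (2 * m). weight i) = (\<Sum>i<2 * m. weight i + weight (i + 2 * m))"
      by (simp add: sum.distrib)
    also have "\<dots> = (\<Sum>j<m. if j \<in> D then 5 * a j else 4 * a j)"
      unfolding sum_paired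
    proof (intro sum.cong refl)
      fix j assume "j \<in> {..<m}"
      then have j: "j < m" by simp
      show "weight j + weight (j + 2 * m) + (weight (2 * m - 1 - j) + weight (2 * m - 1 - j + 2 * m)) =
          (if j \<in> D then 5 * a j else 4 * a j)"
        unfolding weight_simps[OF j] by simp
    qed
    finally show ?thesis using total by simp
  qed
  ultimately show ?thesis using pos by (auto simp: admissible_weight_def)
qed

abbreviation \<mu> :: "real measure" where
  "\<mu> \<equiv> self_similar_measure (2 * m) weight"

sublocale self_similar "2 * m" weight \<mu>
  using m2 admissible by (intro self_similar_measure) auto

text \<open>The partition sum of level \<open>n\<close> is \<open>moment q n 1 0\<close>. The second argument is needed for the
  recursion in \<open>n\<close>; after a digit outside \<open>D\<close> the pair \<open>(1, 1)\<close> is reached, up to a factor.\<close>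

definition moment :: "real \<Rightarrow> nat \<Rightarrow> real \<Rightarrow> real \<Rightarrow> real" where
  "moment q n x y =
    (\<Sum>k<(2 * m) ^ n. (x * adic_mass n k + y * adic_mass n ((2 * m) ^ n - 1 - k)) powr q)"

lemma moment_0: "moment q 0 x y = (x + y) powr q"
  by (simp add: moment_def adic_mass_0)

lemma moment_scale:
  "(\<Sum>k<(2 * m) ^ n. (t * (x * adic_mass n k + y * adic_mass n ((2 * m) ^ n - 1 - k))) powr q) =
    t powr q * moment q n x y"
  unfolding moment_def sum_distrib_left
  by (intro sum.cong refl powr_mult)

lemma moment_Suc:
  "moment q (Suc n) x y = full_sum q * (x + y) powr q * moment q n 1 1 +
    diag_sum q * (moment q n (4 * x) y + moment q n x (4 * y))"
proof -
  define L where "L = (2 * m) ^ n"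
  have L: "(2 * m) ^ Suc n = 2 * m * L" "L > 0" using m2 by (auto simp: L_def)
  define A where "A k = adic_mass n k" for k
  define f where "f k = (x * adic_mass (Suc n) k + y * adic_mass (Suc n) (2 * m * L - 1 - k)) powr q" for k
  define g where "g j = (\<Sum>k<L. f (j * L + k))" for j
  have fjk: "f (j * L + k) =
      (x * (weight j * A k + weight (j + 2 * m) * A (L - 1 - k)) +
       y * (weight (2 * m - 1 - j) * A (L - 1 - k) + weight (2 * m - 1 - j + 2 * m) * A k)) powr q"
    if "j < 2 * m" "k < L" for j k
  proof -
    have "2 * m * L - 1 - (j * L + k) = (2 * m - 1 - j) * L + (L - 1 - k)"
    proof -
      obtain j' where j': "2 * m = j + 1 + j'" using \<open>j < 2 * m\<close> by (metis add.commute add_Suc less_natE plus_1_eq_Suc add.assoc)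
      obtain k' where k': "L = k + 1 + k'" using \<open>k < L\<close> by (metis add.commute add_Suc less_natE plus_1_eq_Suc add.assoc)
      have "2 * m * L = j * L + L + j' * L" unfolding j' by (simp add: algebra_simps)
      moreover have "2 * m - 1 - j = j'" "L - 1 - k = k'" using j' k' by auto
      ultimately show ?thesis using k' by simp
    qed
    moreover have "L - 1 - (L - 1 - k) = k" using that by simp
    moreover have "2 * m - 1 - j < 2 * m" "L - 1 - k < L" using that by auto
    ultimately show ?thesis
      using that adic_mass_Suc[of j k n] adic_mass_Suc[of "2 * m - 1 - j" "L - 1 - k" n]
      by (simp add: f_def A_def L_def)
  qed
  have "moment q (Suc n) x y = (\<Sum>k<2 * m * L. f k)"
    unfolding moment_def f_def L(1) ..
  also have "\<dots> = (\<Sum>j<2 * m. g j)"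
  proof -
    have "g j = sum f {j * L..<j * L + L}" for j
      using sum.shift_bounds_nat_ivl[of f 0 "j * L" L]
      by (simp add: g_def atLeast0LessThan add.commute)
    then show ?thesis by (simp add: sum.nat_group)
  qed
  also have "\<dots> = (\<Sum>j<m. g j + g (2 * m - 1 - j))"
    by (rule sum_paired)
  also have "\<dots> = (\<Sum>j<m. (if j \<in> D then 0 else 2 * a j powr q) * ((x + y) powr q * moment q n 1 1) +
      (if j \<in> D then a j powr q else 0) * (moment q n (4 * x) y + moment q n x (4 * y)))"
  proof (intro sum.cong refl)
    fix j assume "j \<in> {..<m}"
    then have j: "j < m" by simp
    then have j': "2 * m - 1 - (2 * m - 1 - j) = j" "j < 2 * m" "2 * m - 1 - j < 2 * m" by auto
    show "g j + g (2 * m - 1 - j) =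
      (if j \<in> D then 0 else 2 * a j powr q) * ((x + y) powr q * moment q n 1 1) +
      (if j \<in> D then a j powr q else 0) * (moment q n (4 * x) y + moment q n x (4 * y))"
    proof (cases "j \<in> D")
      case True
      have "f (j * L + k) = (a j * (x * A k + 4 * y * A (L - 1 - k))) powr q" if "k < L" for k
        unfolding fjk[OF j'(2) that] weight_simps[OF j] by (simp add: True algebra_simps)
      then have "g j = (\<Sum>k<L. (a j * (x * A k + 4 * y * A (L - 1 - k))) powr q)"
        unfolding g_def by (intro sum.cong) auto
      moreover have "f ((2 * m - 1 - j) * L + k) = (a j * (4 * x * A k + y * A (L - 1 - k))) powr q"
        if "k < L" for k
        unfolding fjk[OF j'(3) that] j'(1) weight_simps[OF j] by (simp add: True algebra_simps)
      then have "g (2 * m - 1 - j) = (\<Sum>k<L. (a j * (4 * x * A k + y * A (L - 1 - k))) powr q)"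
        unfolding g_def by (intro sum.cong) auto
      ultimately show ?thesis
        using True moment_scale[where t="a j" and x="4 * x" and y=y and n=n and q=q]
          moment_scale[where t="a j" and x=x and y="4 * y" and n=n and q=q]
        by (simp add: A_def L_def algebra_simps)
    next
      case False
      have "f (j * L + k) = (a j * (x + y) * (1 * A k + 1 * A (L - 1 - k))) powr q" if "k < L" for k
        unfolding fjk[OF j'(2) that] weight_simps[OF j] by (simp add: False algebra_simps)
      then have "g j = (\<Sum>k<L. (a j * (x + y) * (1 * A k + 1 * A (L - 1 - k))) powr q)"
        unfolding g_def by (intro sum.cong) auto
      moreover have "f ((2 * m - 1 - j) * L + k) = (a j * (x + y) * (1 * A k + 1 * A (L - 1 - k))) powr q"
        if "k < L" for k
        unfolding fjk[OF j'(3) that] j'(1) weight_simps[OF j] by (simp add: False algebra_simps)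
      then have "g (2 * m - 1 - j) = (\<Sum>k<L. (a j * (x + y) * (1 * A k + 1 * A (L - 1 - k))) powr q)"
        unfolding g_def by (intro sum.cong) auto
      ultimately show ?thesis
        using False moment_scale[where t="a j * (x + y)" and x=1 and y=1 and n=n and q=q]
        by (simp add: A_def L_def powr_mult)
    qed
  qed
  also have "\<dots> = full_sum q * ((x + y) powr q * moment q n 1 1) +
      diag_sum q * (moment q n (4 * x) y + moment q n x (4 * y))"
    unfolding full_sum_def diag_sum_def sum.distrib sum_distrib_right ..
  finally show ?thesis by (simp add: mult.assoc)
qed

text \<open>The address of an interval splits into its initial run of digits in \<open>D\<close>, the digit
  outside \<open>D\<close> that follows, and the rest.\<close>

lemma moment_renewal:
  "moment q n x y = diag_sum q ^ n * pair_sum q n x y +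
    (\<Sum>k<n. diag_sum q ^ k * pair_sum q k x y * full_sum q * moment q (n - 1 - k) 1 1)"
proof (induction n arbitrary: x y)
  case 0
  then show ?case by (simp add: moment_0)
next
  case (Suc n)
  define R where "R x y = (\<Sum>k<n. diag_sum q ^ k * pair_sum q k x y * full_sum q * moment q (n - 1 - k) 1 1)" for x y
  have IH: "moment q n x y = diag_sum q ^ n * pair_sum q n x y + R x y" for x y
    unfolding R_def by (rule Suc.IH)
  have "(\<Sum>k<Suc n. diag_sum q ^ k * pair_sum q k x y * full_sum q * moment q (Suc n - 1 - k) 1 1) =
    (x + y) powr q * full_sum q * moment q n 1 1 +
    (\<Sum>k<n. diag_sum q * diag_sum q ^ k * (pair_sum q k (4 * x) y + pair_sum q k x (4 * y)) *
      full_sum q * moment q (n - 1 - k) 1 1)"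
    by (subst sum.lessThan_Suc_shift) simp
  also have "(\<Sum>k<n. diag_sum q * diag_sum q ^ k * (pair_sum q k (4 * x) y + pair_sum q k x (4 * y)) *
      full_sum q * moment q (n - 1 - k) 1 1) = diag_sum q * (R (4 * x) y + R x (4 * y))"
    unfolding R_def sum.distrib[symmetric] sum_distrib_left
    by (intro sum.cong refl) (simp add: algebra_simps)
  finally show ?case
    unfolding moment_Suc IH[of "4 * x"] IH[of x "4 * y"] by (simp add: algebra_simps)
qed

text \<open>Intervals of mass \<open>0\<close> may be included, since \<open>0 powr q = 0\<close>.\<close>

lemma partition_sum:
  "(\<Sum>I\<in>{I \<in> adic_intervals (2 * m) n. measure \<mu> I \<noteq> 0}. measure \<mu> I powr q) = moment q n 1 0"
proof -
  define I where "I k = {real k / real (2 * m) ^ n ..< (real k + 1) / real (2 * m) ^ n}" for k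
  have inj: "inj_on I S" for S
  proof (rule inj_onI)
    fix k k' assume "I k = I k'"
    moreover have "real k / real (2 * m) ^ n < (real k + 1) / real (2 * m) ^ n" for k
      using m2 by (intro divide_strict_right_mono) auto
    ultimately have "real k / real (2 * m) ^ n = real k' / real (2 * m) ^ n"
      unfolding I_def by (subst (asm) Ico_eq_Ico) (meson less_le_not_le)
    then show "k = k'" using m2 by simp
  qed
  have adic: "adic_intervals (2 * m) n = I ` {..<(2 * m) ^ n}"
    by (auto simp: adic_intervals_def I_def)
  have "(\<Sum>I\<in>{I \<in> adic_intervals (2 * m) n. measure \<mu> I \<noteq> 0}. measure \<mu> I powr q) =
      (\<Sum>I\<in>adic_intervals (2 * m) n. measure \<mu> I powr q)"
    by (rule sum.mono_neutral_left) (auto simp: adic)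
  also have "\<dots> = (\<Sum>k<(2 * m) ^ n. measure \<mu> (I k) powr q)"
    unfolding adic by (subst sum.reindex[OF inj]) simp
  also have "\<dots> = moment q n 1 0"
    by (simp add: moment_def adic_mass_def I_def)
  finally show ?thesis .
qed

end

section \<open>Growth of renewal sequences\<close>

text \<open>Here \<open>W\<close> is the renewal sequence with inter-arrival weights \<open>g * B k\<close> (time \<open>k + 1\<close>) and \<open>Z\<close> the
  sequence delayed by a first run of growth rate \<open>\<alpha>\<close>. The generating function evaluated at \<open>1 / s\<close>
  decides whether \<open>Z\<close> grows faster than \<open>s ^ n\<close>.\<close>

lemma renewal_upper:
  fixes B W Z :: "nat \<Rightarrow> real"
  assumes B: "\<And>n. 0 \<le> B n" and g: "0 < g" and \<alpha>: "0 < \<alpha>" and s: "\<alpha> < s"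
    and W: "\<And>n. W n = B n + g * (\<Sum>k<n. B k * W (n - 1 - k))"
    and Z: "\<And>n. Z n = \<alpha> ^ n + g * (\<Sum>k<n. \<alpha> ^ k * W (n - 1 - k))"
    and F: "summable (\<lambda>k. B k / s ^ Suc k)" "g * (\<Sum>k. B k / s ^ Suc k) \<le> 1"
  shows "\<exists>C. \<forall>n. Z n \<le> C * s ^ n"
proof -
  have s0: "0 < s" using \<alpha> s by simp
  \<comment> \<open>The tail of the series that starts with term \<open>n\<close> absorbs the new term \<open>B n\<close>.\<close>
  have Wle: "W n \<le> s ^ Suc n / g" for n
  proof (induction n rule: less_induct)
    case (less n)
    have "(\<Sum>k<n. B k * W (n - 1 - k)) \<le> (\<Sum>k<n. B k * (s ^ (n - k) / g))"
    proof (intro sum_mono mult_left_mono B)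
      fix k assume k: "k \<in> {..<n}"
      then have e: "Suc (n - 1 - k) = n - k" by auto
      show "W (n - 1 - k) \<le> s ^ (n - k) / g"
        using less.IH[of "n - 1 - k"] k unfolding e by simp
    qed
    also have "\<dots> = s ^ Suc n / g * (\<Sum>k<n. B k / s ^ Suc k)"
      unfolding sum_distrib_left
    proof (intro sum.cong refl)
      fix k assume "k \<in> {..<n}"
      then have "s ^ Suc n = s ^ (n - k) * s ^ Suc k" by (simp flip: power_add)
      then show "B k * (s ^ (n - k) / g) = s ^ Suc n / g * (B k / s ^ Suc k)"
        using s0 by (simp add: field_simps)
    qed
    finally have "W n \<le> B n + s ^ Suc n * (\<Sum>k<n. B k / s ^ Suc k)"
      using g W[of n] by (simp add: field_simps)
    also have "\<dots> = s ^ Suc n * (\<Sum>k<Suc n. B k / s ^ Suc k)"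
      using s0 by (simp add: field_simps)
    also have "\<dots> \<le> s ^ Suc n * (\<Sum>k. B k / s ^ Suc k)"
      using s0 B by (intro mult_left_mono sum_le_suminf[OF F(1)]) auto
    also have "\<dots> \<le> s ^ Suc n * (1 / g)"
      using F(2) g s0 by (intro mult_left_mono) (auto simp: field_simps)
    finally show ?case by simp
  qed
  define r where "r = \<alpha> / s"
  have r: "0 < r" "r < 1" using \<alpha> s by (auto simp: r_def)
  have "Z n \<le> (1 + 1 / (1 - r)) * s ^ n" for n
  proof -
    have "g * (\<Sum>k<n. \<alpha> ^ k * W (n - 1 - k)) \<le> g * (\<Sum>k<n. \<alpha> ^ k * (s ^ (n - k) / g))"
    proof (intro mult_left_mono sum_mono)
      fix k assume k: "k \<in> {..<n}"
      then have e: "Suc (n - 1 - k) = n - k" by auto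
      show "W (n - 1 - k) \<le> s ^ (n - k) / g"
        using Wle[of "n - 1 - k"] unfolding e .
    qed (use g \<alpha> in auto)
    also have "\<dots> = s ^ n * (\<Sum>k<n. r ^ k)"
      unfolding sum_distrib_left
    proof (intro sum.cong refl)
      fix k assume "k \<in> {..<n}"
      then have "s ^ n = s ^ (n - k) * s ^ k" by (simp flip: power_add)
      then show "g * (\<alpha> ^ k * (s ^ (n - k) / g)) = s ^ n * r ^ k"
        using s0 g by (simp add: r_def power_divide)
    qed
    also have "\<dots> \<le> s ^ n * (\<Sum>k. r ^ k)"
      using s0 r by (intro mult_left_mono sum_le_suminf summable_geometric) auto
    also have "(\<Sum>k. r ^ k) = 1 / (1 - r)" using r by (intro suminf_geometric) auto
    finally have "g * (\<Sum>k<n. \<alpha> ^ k * W (n - 1 - k)) \<le> s ^ n * (1 / (1 - r))" .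
    moreover have "\<alpha> ^ n \<le> s ^ n" using \<alpha> s by (intro power_mono) auto
    ultimately have "Z n \<le> s ^ n + s ^ n * (1 / (1 - r))"
      unfolding Z[of n] by (rule add_mono[rotated])
    then show ?thesis by (simp add: algebra_simps)
  qed
  then show ?thesis by blast
qed

lemma renewal_lower:
  fixes B W Z :: "nat \<Rightarrow> real"
  assumes B: "\<And>n. 0 < B n" and g: "0 < g" and \<alpha>: "0 < \<alpha>" and s: "0 < s"
    and W: "\<And>n. W n = B n + g * (\<Sum>k<n. B k * W (n - 1 - k))"
    and Z: "\<And>n. Z n = \<alpha> ^ n + g * (\<Sum>k<n. \<alpha> ^ k * W (n - 1 - k))"
    and F: "summable (\<lambda>k. B k / s ^ Suc k)" "1 < g * (\<Sum>k. B k / s ^ Suc k)"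
  shows "\<exists>c>0. \<forall>n>0. c * s ^ n \<le> Z n"
proof -
  have Wpos: "0 < W n" for n
  proof (induction n rule: less_induct)
    case (less n)
    have "0 \<le> (\<Sum>k<n. B k * W (n - 1 - k))"
      using less B by (intro sum_nonneg mult_nonneg_nonneg) (auto simp: less_imp_le)
    then show ?case using W[of n] B[of n] g by (simp add: add_pos_nonneg)
  qed
  have "(\<lambda>n. g * (\<Sum>k<n. B k / s ^ Suc k)) \<longlonglongrightarrow> g * (\<Sum>k. B k / s ^ Suc k)"
    by (intro tendsto_mult tendsto_const summable_LIMSEQ F)
  \<comment> \<open>A finite part of the series exceeds \<open>1\<close> already, so finitely many values of \<open>W\<close> propagate.\<close>
  from order_tendstoD(1)[OF this F(2)]
  obtain N where N: "1 < g * (\<Sum>k<N. B k / s ^ Suc k)"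
    by (auto simp: eventually_sequentially)
  define c where "c = Min ((\<lambda>n. W n / s ^ n) ` {..N})"
  have c: "0 < c" unfolding c_def using Wpos s by (subst Min_gr_iff) auto
  have cW: "c * s ^ n \<le> W n" for n
  proof (induction n rule: less_induct)
    case (less n)
    show ?case
    proof (cases "n \<le> N")
      case True
      then have "c \<le> W n / s ^ n" unfolding c_def by (intro Min_le) auto
      then show ?thesis using s by (simp add: field_simps)
    next
      case False
      have "c * s ^ n * 1 \<le> c * s ^ n * (g * (\<Sum>k<N. B k / s ^ Suc k))"
        using N c s by (intro mult_left_mono) auto
      then have "c * s ^ n \<le> c * s ^ n * (g * (\<Sum>k<N. B k / s ^ Suc k))" by simp
      also have "\<dots> = g * (\<Sum>k<N. B k * (c * s ^ (n - 1 - k)))"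
        unfolding sum_distrib_left
      proof (intro sum.cong refl)
        fix k assume "k \<in> {..<N}"
        then have "s ^ n = s ^ (n - 1 - k) * s ^ Suc k"
          using False by (simp flip: power_add power_Suc)
        then show "c * s ^ n * (g * (B k / s ^ Suc k)) = g * (B k * (c * s ^ (n - 1 - k)))"
          using s by (simp add: field_simps)
      qed
      also have "\<dots> \<le> g * (\<Sum>k<N. B k * W (n - 1 - k))"
        using less.IH False B g by (intro mult_left_mono sum_mono) (auto simp: less_imp_le)
      also have "\<dots> \<le> g * (\<Sum>k<n. B k * W (n - 1 - k))"
        using False B g Wpos
        by (intro mult_left_mono sum_mono2) (auto simp: less_imp_le)
      also have "\<dots> \<le> W n" using W[of n] B[of n] by simp
      finally show ?thesis .
    qed
  qed
  have "g * c / s * s ^ n \<le> Z n" if n0: "n > 0" for n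
  proof -
    obtain n' where n: "n = Suc n'" using gr0_implies_Suc[OF n0] by blast
    have "g * c / s * s ^ n = g * (c * s ^ n')" using s by (simp add: n)
    also have "\<dots> \<le> g * W n'" using cW[of n'] g by simp
    also have "\<dots> \<le> g * (\<Sum>k<n. \<alpha> ^ k * W (n - 1 - k))"
    proof (intro mult_left_mono)
      show "W n' \<le> (\<Sum>k<n. \<alpha> ^ k * W (n - 1 - k))"
        using member_le_sum[of 0 "{..<n}" "\<lambda>k. \<alpha> ^ k * W (n - 1 - k)"] \<alpha> Wpos
        by (auto simp: n less_imp_le)
    qed (use g in simp)
    also have "\<dots> \<le> Z n" using Z[of n] \<alpha> by simp
    finally show ?thesis .
  qed
  moreover have "0 < g * c / s" using g c s by simp
  ultimately show ?thesis by blast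
qed

section \<open>Growth rates and the spectrum\<close>

lemma Lq_spectrum_bounds:
  assumes l: "2 \<le> l"
    and Z: "\<And>n. (\<Sum>I\<in>{I \<in> adic_intervals l n. measure M I \<noteq> 0}. measure M I powr q) = Z n"
    and lower: "0 < c" "0 < s" "\<And>n. 0 < n \<Longrightarrow> c * s ^ n \<le> Z n"
    and upper: "0 < t" "\<And>n. 0 < n \<Longrightarrow> Z n \<le> C * t ^ n"
  shows "ln s \<le> Lq_spectrum l M q * ln (real l)" "Lq_spectrum l M q * ln (real l) \<le> ln t"
proof -
  have lnl: "ln (real l) > 0" using l by simp
  define f where "f n = 1 / (real n * ln (real l)) * ln (Z n)" for n
  have C: "0 < C"
  proof -
    have "0 < c * s ^ 1" using lower by simp
    also have "\<dots> \<le> C * t ^ 1" using lower(3)[of 1] upper(2)[of 1] by simp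
    finally show ?thesis using upper(1) by (simp add: zero_less_mult_iff)
  qed
  have lin: "(\<lambda>n. (ln b + real n * ln r) / (real n * ln (real l))) \<longlonglongrightarrow> ln r / ln (real l)" for b r
  proof -
    have "(\<lambda>n. ln b / ln (real l) * (1 / real n) + ln r / ln (real l)) \<longlonglongrightarrow>
        ln b / ln (real l) * 0 + ln r / ln (real l)"
      by (intro tendsto_intros lim_1_over_n)
    moreover have "\<forall>\<^sub>F n in sequentially. ln b / ln (real l) * (1 / real n) + ln r / ln (real l) =
        (ln b + real n * ln r) / (real n * ln (real l))"
      by (rule eventually_mono[OF eventually_gt_at_top[of 0]]) (use lnl in \<open>simp add: field_simps\<close>)
    ultimately show ?thesis by (auto intro: Lim_transform_eventually)
  qed
  have ge: "(ln c + real n * ln s) / (real n * ln (real l)) \<le> f n"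
    and le: "f n \<le> (ln C + real n * ln t) / (real n * ln (real l))" if "n > 0" for n
  proof -
    have pos: "0 < c * s ^ n" "0 < C * t ^ n" using lower upper C by auto
    then have "0 < Z n" using lower(3)[OF that] by linarith
    have "ln (c * s ^ n) = ln c + real n * ln s" "ln (C * t ^ n) = ln C + real n * ln t"
      using lower upper C by (simp_all add: ln_mult ln_realpow)
    moreover have "ln (c * s ^ n) \<le> ln (Z n)" "ln (Z n) \<le> ln (C * t ^ n)"
      using lower(3)[OF that] upper(2)[OF that] pos \<open>0 < Z n\<close> by simp_all
    moreover have "0 < real n * ln (real l)" using that lnl by simp
    ultimately show "(ln c + real n * ln s) / (real n * ln (real l)) \<le> f n"
      "f n \<le> (ln C + real n * ln t) / (real n * ln (real l))"
      by (auto simp: f_def intro!: divide_right_mono)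
  qed
  have L: "Lq_spectrum l M q = real_of_ereal (limsup (\<lambda>n. ereal (f n)))"
    unfolding Lq_spectrum_def Z f_def ..
  have "eventually (\<lambda>n. (ln c + real n * ln s) / (real n * ln (real l)) \<le> f n) sequentially"
    using eventually_gt_at_top[of 0] by (rule eventually_mono) (rule ge)
  then have ev: "eventually (\<lambda>n. ereal ((ln c + real n * ln s) / (real n * ln (real l))) \<le> ereal (f n))
      sequentially" by simp
  have 1: "ereal (ln s / ln (real l)) \<le> limsup (\<lambda>n. ereal (f n))"
  proof -
    have "limsup (\<lambda>n. ereal ((ln c + real n * ln s) / (real n * ln (real l)))) = ereal (ln s / ln (real l))"
      by (intro lim_imp_Limsup) (auto intro: lin)
    then show ?thesis
      using Limsup_mono[of "\<lambda>n. ereal ((ln c + real n * ln s) / (real n * ln (real l)))" "\<lambda>n. ereal (f n)" sequentially, OF ev] by simp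
  qed
  have "eventually (\<lambda>n. f n \<le> (ln C + real n * ln t) / (real n * ln (real l))) sequentially"
    using eventually_gt_at_top[of 0] by (rule eventually_mono) (rule le)
  then have ev: "eventually (\<lambda>n. ereal (f n) \<le> ereal ((ln C + real n * ln t) / (real n * ln (real l))))
      sequentially" by simp
  have 2: "limsup (\<lambda>n. ereal (f n)) \<le> ereal (ln t / ln (real l))"
  proof -
    have "limsup (\<lambda>n. ereal ((ln C + real n * ln t) / (real n * ln (real l)))) = ereal (ln t / ln (real l))"
      by (intro lim_imp_Limsup) (auto intro: lin)
    then show ?thesis
      using Limsup_mono[of "\<lambda>n. ereal (f n)" "\<lambda>n. ereal ((ln C + real n * ln t) / (real n * ln (real l)))" sequentially, OF ev] by simp
  qed
  from 1 2 obtain x where x: "limsup (\<lambda>n. ereal (f n)) = ereal x"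
    by (cases "limsup (\<lambda>n. ereal (f n))") auto
  then show "ln s \<le> Lq_spectrum l M q * ln (real l)" "Lq_spectrum l M q * ln (real l) \<le> ln t"
    using 1 2 lnl by (auto simp: L field_simps)
qed

section \<open>The generating function of the runs\<close>

text \<open>The derivative of \<^const>\<open>pair_sum\<close> with respect to \<open>q\<close>.\<close>

primrec pair_sum_deriv :: "real \<Rightarrow> nat \<Rightarrow> real \<Rightarrow> real \<Rightarrow> real" where
  "pair_sum_deriv q 0 x y = (x + y) powr q * ln (x + y)"
| "pair_sum_deriv q (Suc n) x y = pair_sum_deriv q n (4 * x) y + pair_sum_deriv q n x (4 * y)"

lemma pair_sum_has_derivative:
  assumes "0 < x" "0 < y"
  shows "((\<lambda>q. pair_sum q n x y) has_field_derivative pair_sum_deriv q n x y) (at q)"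
  using assms
  by (induction n arbitrary: x y) (auto intro!: derivative_eq_intros)

lemma pair_sum_deriv_bound:
  assumes "1 \<le> x" "1 \<le> y"
  shows "\<bar>pair_sum_deriv q n x y\<bar> \<le> (real n * ln 4 + ln (x + y)) * pair_sum q n x y"
  using assms
proof (induction n arbitrary: x y)
  case 0
  then show ?case by (simp add: abs_mult mult.commute)
next
  case (Suc n)
  have 1: "ln (4 * x + y) \<le> ln 4 + ln (x + y)" "ln (x + 4 * y) \<le> ln 4 + ln (x + y)"
  proof -
    have "ln (4 * x + y) \<le> ln (4 * (x + y))" "ln (x + 4 * y) \<le> ln (4 * (x + y))"
      using Suc.prems by simp_all
    moreover have "ln (4 * (x + y)) = ln 4 + ln (x + y)"
      using Suc.prems by (intro ln_mult_pos) auto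
    ultimately show "ln (4 * x + y) \<le> ln 4 + ln (x + y)" "ln (x + 4 * y) \<le> ln 4 + ln (x + y)"
      by simp_all
  qed
  have pos: "0 < pair_sum q n (4 * x) y" "0 < pair_sum q n x (4 * y)"
    using Suc.prems by (auto intro!: pair_sum_pos)
  have "\<bar>pair_sum_deriv q (Suc n) x y\<bar> \<le>
      (real n * ln 4 + ln (4 * x + y)) * pair_sum q n (4 * x) y +
      (real n * ln 4 + ln (x + 4 * y)) * pair_sum q n x (4 * y)"
    using Suc.IH[of "4 * x" y] Suc.IH[of x "4 * y"] Suc.prems by simp
  also have "\<dots> \<le> (real (Suc n) * ln 4 + ln (x + y)) * pair_sum q n (4 * x) y +
      (real (Suc n) * ln 4 + ln (x + y)) * pair_sum q n x (4 * y)"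
  proof -
    have "real n * ln 4 + ln (4 * x + y) \<le> real (Suc n) * ln 4 + ln (x + y)"
      "real n * ln 4 + ln (x + 4 * y) \<le> real (Suc n) * ln 4 + ln (x + y)"
      using 1 by (simp_all add: distrib_right)
    then show ?thesis using pos by (intro add_mono[OF mult_right_mono mult_right_mono]) auto
  qed
  finally show ?case by (simp add: algebra_simps)
qed

lemma pair_sum_ge:
  "0 \<le> q \<Longrightarrow> 0 < x \<Longrightarrow> 0 \<le> y \<Longrightarrow> x powr q * (1 + 4 powr q) ^ n \<le> pair_sum q n x y"
proof (induction n arbitrary: x y)
  case (Suc n)
  show ?case
    using Suc.IH[of "4 * x" y] Suc.IH[of x "4 * y"] Suc.prems by (simp add: powr_mult algebra_simps)
qed (simp add: powr_mono2)

lemma pair_sum_le_nonpos: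
  "q \<le> 0 \<Longrightarrow> 0 < x \<Longrightarrow> 0 \<le> y \<Longrightarrow> pair_sum q n x y \<le> x powr q * (1 + 4 powr q) ^ n"
proof (induction n arbitrary: x y)
  case (Suc n)
  show ?case
    using Suc.IH[of "4 * x" y] Suc.IH[of x "4 * y"] Suc.prems by (simp add: powr_mult algebra_simps)
qed (simp add: powr_mono2')

lemma pair_sum_le_nonneg:
  "0 \<le> q \<Longrightarrow> 0 < x \<Longrightarrow> 0 < y \<Longrightarrow>
    pair_sum q n x y \<le> 2 powr q * (x powr q + y powr q) * (1 + 4 powr q) ^ n"
proof (induction n arbitrary: x y)
  case 0
  have "(x + y) powr q \<le> (2 * max x y) powr q"
    using 0 by (intro powr_mono2) auto
  also have "\<dots> \<le> 2 powr q * (x powr q + y powr q)"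
    by (auto simp: powr_mult max_def)
  finally show ?case by simp
next
  case (Suc n)
  show ?case
    using Suc.IH[of "4 * x" y] Suc.IH[of x "4 * y"] Suc.prems by (simp add: powr_mult algebra_simps)
qed

text \<open>For \<open>q \<le> 0\<close> the larger component rules: the bound \<open>sqrt (x * y) \<le> x + y\<close> yields a growth rate
  \<open>2 * 2 powr q\<close> that is smaller than \<open>1 + 4 powr q\<close>.\<close>

lemma pair_sum_le_neg:
  "q \<le> 0 \<Longrightarrow> 0 < x \<Longrightarrow> 0 < y \<Longrightarrow> pair_sum q n x y \<le> sqrt (x * y) powr q * (2 * 2 powr q) ^ n"
proof (induction n arbitrary: x y)
  case 0
  have "sqrt (x * y) \<le> x + y"
  proof (rule real_le_lsqrt)
    show "x * y \<le> (x + y)\<^sup>2" using 0 by (simp add: power2_eq_square algebra_simps)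
  qed (use 0 in auto)
  then show ?case using 0 by (auto intro: powr_mono2')
next
  case (Suc n)
  have "sqrt (4 * x * y) = 2 * sqrt (x * y)" "sqrt (x * (4 * y)) = 2 * sqrt (x * y)"
    by (simp_all add: real_sqrt_mult)
  then show ?case
    using Suc.IH[of "4 * x" y] Suc.IH[of x "4 * y"] Suc.prems by (simp add: powr_mult algebra_simps)
qed

text \<open>The contribution of the runs of length \<open>n\<close> of digits in \<open>D\<close>, between two digits outside \<open>D\<close>,
  relative to an initial run of the same length.\<close>

definition run :: "nat \<Rightarrow> real \<Rightarrow> real" where
  "run n q = pair_sum q n 1 1 / (1 + 4 powr q) ^ n"

definition run_deriv :: "nat \<Rightarrow> real \<Rightarrow> real" where
  "run_deriv n q = pair_sum_deriv q n 1 1 / (1 + 4 powr q) ^ n -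
     real n * (4 powr q * ln 4 / (1 + 4 powr q)) * run n q"

lemma one_plus_powr_pos: "0 < 1 + (4::real) powr q"
  by (simp add: add_pos_pos)

lemma run_pos: "0 < run n q"
  by (simp add: run_def pair_sum_pos one_plus_powr_pos)

lemma run_has_derivative: "(run n has_field_derivative run_deriv n q) (at q)"
proof -
  have b: "(1::real) + 4 powr q \<noteq> 0" using one_plus_powr_pos[of q] by linarith
  have "((\<lambda>q. pair_sum q n 1 1 / (1 + 4 powr q) ^ n) has_field_derivative
      (pair_sum_deriv q n 1 1 * (1 + 4 powr q) ^ n -
        pair_sum q n 1 1 * (real n * (4 powr q * ln 4) * (1 + 4 powr q) ^ (n - 1))) /
      ((1 + 4 powr q) ^ n * (1 + 4 powr q) ^ n)) (at q)"
    using b by (auto intro!: derivative_eq_intros pair_sum_has_derivative)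
  moreover have "(pair_sum_deriv q n 1 1 * (1 + 4 powr q) ^ n -
        pair_sum q n 1 1 * (real n * (4 powr q * ln 4) * (1 + 4 powr q) ^ (n - 1))) /
      ((1 + 4 powr q) ^ n * (1 + 4 powr q) ^ n) = run_deriv n q"
  proof -
    have "(P' * A ^ n - P * (real n * B * A ^ (n - 1))) / (A ^ n * A ^ n) =
        P' / A ^ n - real n * (B / A) * (P / A ^ n)" if "A \<noteq> 0" for A B P P' :: real
      using that by (cases n) (auto simp: field_simps)
    then show ?thesis unfolding run_deriv_def run_def using b by blast
  qed
  ultimately show ?thesis by (simp add: run_def[abs_def])
qed

lemma run_deriv_bound: "\<bar>run_deriv n q\<bar> \<le> 3 * real (Suc n) * run n q"
proof -
  have p: "0 < 1 + (4::real) powr q" by (rule one_plus_powr_pos)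
  have ln2: "ln (2::real) \<le> 3 / 4" using ln2_le_25_over_36 by simp
  have ln4: "ln (4::real) = 2 * ln 2" using ln_realpow[of "2::real" 2] by simp
  have "\<bar>pair_sum_deriv q n 1 1 / (1 + 4 powr q) ^ n\<bar> \<le>
      (real n * ln 4 + ln 2) * pair_sum q n 1 1 / (1 + 4 powr q) ^ n"
    using pair_sum_deriv_bound[of 1 1 q n] p by (simp add: abs_divide divide_right_mono)
  also have "\<dots> = (real n * ln 4 + ln 2) * run n q" by (simp add: run_def)
  finally have 1: "\<bar>pair_sum_deriv q n 1 1 / (1 + 4 powr q) ^ n\<bar> \<le> (real n * ln 4 + ln 2) * run n q" .
  have "4 powr q * ln 4 / (1 + 4 powr q) \<le> ln (4::real)"
    using p by (simp add: field_simps)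
  then have 2: "\<bar>real n * (4 powr q * ln 4 / (1 + 4 powr q)) * run n q\<bar> \<le> real n * ln 4 * run n q"
  proof -
    have "0 \<le> 4 powr q * ln 4 / (1 + 4 powr q)" using p by simp
    moreover assume "4 powr q * ln 4 / (1 + 4 powr q) \<le> ln (4::real)"
    ultimately show ?thesis
      using run_pos[of n q] unfolding abs_mult
      by (intro mult_mono) auto
  qed
  have "\<bar>run_deriv n q\<bar> \<le> (real n * ln 4 + ln 2) * run n q + real n * ln 4 * run n q"
    unfolding run_deriv_def using 1 2 by linarith
  also have "\<dots> = (real n * 4 + 1) * ln 2 * run n q" by (simp add: ln4 algebra_simps)
  also have "\<dots> \<le> (3 * real (Suc n)) * run n q"
  proof (rule mult_right_mono)
    have "(real n * 4 + 1) * ln 2 \<le> (real n * 4 + 1) * (3 / 4)"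
      using ln2 by (intro mult_left_mono) auto
    then show "(real n * 4 + 1) * ln 2 \<le> 3 * real (Suc n)" by simp
  qed (use run_pos in \<open>simp add: less_imp_le\<close>)
  finally show ?thesis .
qed

lemma run_ge_1: "0 \<le> q \<Longrightarrow> 1 \<le> run n q"
  using pair_sum_ge[of q 1 1 n] one_plus_powr_pos[of q] by (simp add: run_def)

lemma run_le: "run n q \<le> 2 * 2 powr \<bar>q\<bar>"
proof (cases "0 \<le> q")
  case True
  then show ?thesis
    using pair_sum_le_nonneg[of q 1 1 n] one_plus_powr_pos[of q] by (simp add: run_def field_simps)
next
  case False
  then have "run n q \<le> 1"
    using pair_sum_le_nonpos[of q 1 1 n] one_plus_powr_pos[of q] by (simp add: run_def)
  moreover have "(1::real) \<le> 2 powr \<bar>q\<bar>" by (simp add: ge_one_powr_ge_zero)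
  ultimately show ?thesis by linarith
qed

lemma run_le_geometric:
  assumes "q \<le> -1"
  shows "run n q \<le> (4 / 5) ^ n"
proof -
  define x :: real where "x = 2 powr q"
  have x: "0 < x" "x \<le> 1 / 2"
    using assms powr_mono[of q "-1" 2] by (auto simp: x_def powr_minus_divide)
  have x2: "4 powr q = x * x"
    unfolding x_def by (simp flip: powr_mult)
  have "0 \<le> (1 - 2 * x) * (2 - x)" using x by simp
  then have "2 * x / (1 + x * x) \<le> 4 / 5"
    using x by (simp add: field_simps add_pos_pos)
  moreover have "run n q \<le> (2 * x) ^ n / (1 + x * x) ^ n"
  proof -
    have "run n q = pair_sum q n 1 1 / (1 + x * x) ^ n" by (simp add: run_def x2)
    moreover have "pair_sum q n 1 1 \<le> (2 * x) ^ n"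
      using pair_sum_le_neg[of q 1 1 n] assms by (simp add: x_def)
    ultimately show ?thesis using x by (simp add: divide_right_mono)
  qed
  moreover have "(2 * x) ^ n / (1 + x * x) ^ n = (2 * x / (1 + x * x)) ^ n"
    by (simp add: power_divide)
  moreover have "(2 * x / (1 + x * x)) ^ n \<le> (4 / 5) ^ n"
    using calculation(1) x by (intro power_mono) auto
  ultimately show ?thesis by linarith
qed

text \<open>The generating function of \<^const>\<open>run\<close> at \<open>exp (- u)\<close>; \<open>runs_q\<close> is its partial derivative in
  \<open>q\<close>, and \<open>runs_u\<close> is the negative of its partial derivative in \<open>u\<close>.\<close>

definition runs :: "real \<Rightarrow> real \<Rightarrow> real" where
  "runs q u = (\<Sum>n. run n q * exp (- real (Suc n) * u))"

definition runs_q :: "real \<Rightarrow> real \<Rightarrow> real" where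
  "runs_q q u = (\<Sum>n. run_deriv n q * exp (- real (Suc n) * u))"

definition runs_u :: "real \<Rightarrow> real \<Rightarrow> real" where
  "runs_u q u = (\<Sum>n. real (Suc n) * run n q * exp (- real (Suc n) * u))"

text \<open>A sufficient condition for the series to converge geometrically, locally uniformly in \<open>q\<close>. It
  holds for all \<open>u > 0\<close>, and even for \<open>u = 0\<close> when \<open>q < -1\<close>.\<close>

definition runs_dom :: "real \<Rightarrow> real \<Rightarrow> bool" where
  "runs_dom q u \<longleftrightarrow> (\<exists>r>0. \<exists>K>0. \<exists>\<theta>>0. \<theta> * exp (- u) < 1 \<and>
     (\<forall>q'. \<bar>q' - q\<bar> < r \<longrightarrow> (\<forall>n. run n q' \<le> K * \<theta> ^ n)))"

lemma runs_domI:
  assumes "0 < r" "0 < K" "0 < \<theta>" "\<theta> * exp (- u) < 1"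
    "\<And>q' n. \<bar>q' - q\<bar> < r \<Longrightarrow> run n q' \<le> K * \<theta> ^ n"
  shows "runs_dom q u"
  unfolding runs_dom_def using assms by blast

lemma runs_dom_pos:
  assumes "0 < u"
  shows "runs_dom q u"
proof (rule runs_domI)
  fix q' n assume "\<bar>q' - q\<bar> < 1"
  then have "(2::real) powr \<bar>q'\<bar> \<le> 2 powr (\<bar>q\<bar> + 1)" by (intro powr_mono) auto
  then show "run n q' \<le> 2 * 2 powr (\<bar>q\<bar> + 1) * 1 ^ n" using run_le[of n q']
    unfolding power_one mult_1_right by linarith
qed (use assms in auto)

lemma runs_dom_neg:
  assumes "q < -1"
  shows "runs_dom q 0"
  by (rule runs_domI[of "- 1 - q" 1 "4 / 5"]) (use assms in \<open>auto intro!: run_le_geometric\<close>)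

text \<open>Termwise differentiation along the line through \<open>(q, u)\<close> with direction \<open>(d, c)\<close>.\<close>

lemma runs_line_derivative:
  assumes "runs_dom q u"
  shows "((\<lambda>e. runs (q + d * e) (u + c * e)) has_field_derivative
      (d * runs_q q u - c * runs_u q u)) (at 0)"
    and "summable (\<lambda>n. run n q * exp (- real (Suc n) * u))"
    and "summable (\<lambda>n. run_deriv n q * exp (- real (Suc n) * u))"
    and "summable (\<lambda>n. real (Suc n) * run n q * exp (- real (Suc n) * u))"
proof -
  from assms obtain r K \<theta> where r: "0 < r" and K: "0 < K" and \<theta>: "0 < \<theta>" "\<theta> * exp (- u) < 1"
    and bound: "\<And>q' n. \<bar>q' - q\<bar> < r \<Longrightarrow> run n q' \<le> K * \<theta> ^ n"
    unfolding runs_dom_def by blast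
  define x where "x = ln (\<theta> * exp (- u))"
  have x: "x < 0" using \<theta> by (simp add: x_def)
  define A where "A = \<bar>c\<bar> + \<bar>d\<bar> + 1"
  have A: "0 < A" "\<bar>c\<bar> \<le> A" "\<bar>d\<bar> \<le> A" by (auto simp: A_def)
  define \<delta> where "\<delta> = min r (- x / 2) / A"
  have \<delta>: "0 < \<delta>" using r x A by (simp add: \<delta>_def)
  have A\<delta>: "A * \<delta> \<le> r" "A * \<delta> \<le> - x / 2" using A by (auto simp: \<delta>_def)
  define \<kappa> where "\<kappa> = exp (x / 2)"
  have \<kappa>: "0 < \<kappa>" "\<kappa> < 1" using x by (auto simp: \<kappa>_def)
  define S where "S = {-\<delta> <..< \<delta>}"
  have small: "\<bar>b * e\<bar> < A * \<delta>" if "\<bar>b\<bar> \<le> A - 1" "e \<in> S" for b e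
  proof -
    have "\<bar>b * e\<bar> \<le> (A - 1) * \<delta>"
      unfolding abs_mult using that by (intro mult_mono) (auto simp: S_def)
    also have "\<dots> < A * \<delta>" using \<delta> by simp
    finally show ?thesis .
  qed
  have dc: "\<bar>d\<bar> \<le> A - 1" "\<bar>c\<bar> \<le> A - 1" by (auto simp: A_def)
  have B: "run n (q + d * e) * exp (- real (Suc n) * (u + c * e)) \<le> K / \<theta> * \<kappa> ^ Suc n"
    if e: "e \<in> S" for n e
  proof -
    have "\<theta> * exp (- (u + c * e)) = exp (x - c * e)"
      using \<theta> by (simp add: x_def exp_diff exp_add exp_minus field_simps)
    also have "\<dots> \<le> \<kappa>"
      unfolding \<kappa>_def using small[OF dc(2) e] A\<delta> by (simp add: abs_if split: if_splits)
    finally have le: "\<theta> * exp (- (u + c * e)) \<le> \<kappa>" .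
    have "run n (q + d * e) * exp (- real (Suc n) * (u + c * e)) \<le>
        K * \<theta> ^ n * exp (- real (Suc n) * (u + c * e))"
      using bound[of "q + d * e" n] small[OF dc(1) e] A\<delta> by (intro mult_right_mono) auto
    also have "\<dots> = K / \<theta> * (\<theta> * exp (- (u + c * e))) ^ Suc n"
    proof -
      have "exp (- real (Suc n) * (u + c * e)) = exp (- (u + c * e)) ^ Suc n"
        by (simp only: exp_of_nat_mult[symmetric] mult_minus_left mult_minus_right)
      then show ?thesis using \<theta> by (simp add: power_mult_distrib)
    qed
    also have "\<dots> \<le> K / \<theta> * \<kappa> ^ Suc n"
      using le K \<theta> by (intro mult_left_mono power_mono) auto
    finally show ?thesis .
  qed
  have sum1: "summable (\<lambda>n. real (Suc n) * \<kappa> ^ n)"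
    using geometric_deriv_sums[of \<kappa>] \<kappa> by (auto simp: sums_iff)
  define G where "G C n = C * (K / \<theta> * \<kappa>) * (real (Suc n) * \<kappa> ^ n)" for C n
  have Gsum: "summable (G C)" for C
    unfolding G_def by (intro summable_mult sum1)
  have S0: "0 \<in> S" using \<delta> by (simp add: S_def)
  have BG: "real (Suc n) * (run n (q + d * e) * exp (- real (Suc n) * (u + c * e))) \<le> G 1 n"
    if "e \<in> S" for n e
    using mult_left_mono[OF B[OF that], of "real (Suc n)" n] by (simp add: G_def mult_ac)
  define f where "f n e = run n (q + d * e) * exp (- real (Suc n) * (u + c * e))" for n e
  define f' where "f' n e = (d * run_deriv n (q + d * e) - c * real (Suc n) * run n (q + d * e)) *
    exp (- real (Suc n) * (u + c * e))" for n e
  have der: "(f n has_field_derivative f' n e) (at e within S)" for n e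
  proof -
    have "((\<lambda>e. run n (q + d * e)) has_field_derivative run_deriv n (q + d * e) * d) (at e)"
      by (rule DERIV_chain2[OF run_has_derivative]) (auto intro!: derivative_eq_intros)
    then have "(f n has_field_derivative f' n e) (at e)"
      unfolding f_def f'_def
      by (auto intro!: derivative_eq_intros simp: algebra_simps simp del: of_nat_Suc)
    then show ?thesis by (rule has_field_derivative_at_within)
  qed
  have f'_bound: "norm (f' n e) \<le> G (3 * \<bar>d\<bar> + \<bar>c\<bar>) n" if "e \<in> S" for n e
  proof -
    let ?R = "run n (q + d * e)" and ?X = "exp (- real (Suc n) * (u + c * e))"
    have "\<bar>d * run_deriv n (q + d * e) - c * real (Suc n) * ?R\<bar> \<le>
        \<bar>d\<bar> * (3 * real (Suc n) * ?R) + \<bar>c\<bar> * real (Suc n) * ?R"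
      using mult_left_mono[OF run_deriv_bound[of n "q + d * e"], of "\<bar>d\<bar>"] run_pos[of n "q + d * e"]
        abs_triangle_ineq4[of "d * run_deriv n (q + d * e)" "c * real (Suc n) * ?R"]
      by (simp add: abs_mult del: of_nat_Suc)
    then have "norm (f' n e) \<le> (\<bar>d\<bar> * (3 * real (Suc n) * ?R) + \<bar>c\<bar> * real (Suc n) * ?R) * ?X"
      unfolding f'_def by (simp add: abs_mult mult_right_mono del: of_nat_Suc)
    also have "\<dots> = (3 * \<bar>d\<bar> + \<bar>c\<bar>) * (real (Suc n) * (?R * ?X))" by (simp add: algebra_simps)
    also have "\<dots> \<le> (3 * \<bar>d\<bar> + \<bar>c\<bar>) * G 1 n"
      using BG[OF that] by (intro mult_left_mono) auto
    finally show ?thesis by (simp add: G_def)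
  qed
  have at0: "f n 0 = run n q * exp (- real (Suc n) * u)" for n by (simp add: f_def)
  show s2: "summable (\<lambda>n. real (Suc n) * run n q * exp (- real (Suc n) * u))"
    using BG[OF S0] run_pos
    by (intro summable_comparison_test'[OF Gsum[of 1], of 0])
      (simp add: abs_mult abs_of_pos mult.assoc del: of_nat_Suc)
  show s0: "summable (\<lambda>n. run n q * exp (- real (Suc n) * u))"
  proof (rule summable_comparison_test'[OF s2, of 0])
    fix n
    have "1 * (run n q * exp (- real (Suc n) * u)) \<le> real (Suc n) * (run n q * exp (- real (Suc n) * u))"
      using run_pos[of n q] by (intro mult_right_mono) auto
    then show "norm (run n q * exp (- real (Suc n) * u)) \<le> real (Suc n) * run n q * exp (- real (Suc n) * u)"
      using run_pos[of n q] by (simp add: abs_mult mult.assoc)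
  qed
  show s1: "summable (\<lambda>n. run_deriv n q * exp (- real (Suc n) * u))"
  proof (rule summable_comparison_test'[OF summable_mult[OF s2, of 3], of 0])
    fix n
    show "norm (run_deriv n q * exp (- real (Suc n) * u)) \<le>
        3 * (real (Suc n) * run n q * exp (- real (Suc n) * u))"
      using mult_right_mono[OF run_deriv_bound[of n q], of "exp (- real (Suc n) * u)"]
      by (simp add: abs_mult algebra_simps)
  qed
  have "((\<lambda>e. \<Sum>n. f n e) has_field_derivative (\<Sum>n. f' n 0)) (at 0)"
  proof (rule has_field_derivative_series'(2)[where S=S and f'=f'])
    show "convex S" by (simp add: S_def)
    show "uniformly_convergent_on S (\<lambda>n x. \<Sum>i<n. f' i x)"
      by (rule Weierstrass_m_test'[OF f'_bound Gsum])
    show "0 \<in> S" by (rule S0)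
    show "summable (\<lambda>n. f n 0)" unfolding at0 by (rule s0)
    show "0 \<in> interior S" using S0 by (simp add: S_def interior_open)
  qed (rule der)
  moreover have "(\<Sum>n. f' n 0) = d * runs_q q u - c * runs_u q u"
  proof -
    have "f' n 0 = d * (run_deriv n q * exp (- real (Suc n) * u)) -
        c * (real (Suc n) * run n q * exp (- real (Suc n) * u))" for n
      by (simp add: f'_def algebra_simps)
    moreover have "(\<lambda>n. d * (run_deriv n q * exp (- real (Suc n) * u)) -
        c * (real (Suc n) * run n q * exp (- real (Suc n) * u))) sums (d * runs_q q u - c * runs_u q u)"
      unfolding runs_q_def runs_u_def by (intro sums_diff sums_mult summable_sums s1 s2)
    ultimately show ?thesis by (simp only: sums_iff)
  qed
  ultimately show "((\<lambda>e. runs (q + d * e) (u + c * e)) has_field_derivative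
      (d * runs_q q u - c * runs_u q u)) (at 0)"
    by (simp add: runs_def f_def)
qed

lemma runs_u_pos:
  assumes "runs_dom q u"
  shows "0 < runs_u q u"
  unfolding runs_u_def
  by (rule suminf_pos[OF runs_line_derivative(4)[OF assms]]) (auto intro!: mult_pos_pos run_pos)

section \<open>Differentiability of an implicitly given growth rate\<close>

lemma exp_Suc_mult: "exp (- real (Suc n) * u) = exp (- u) ^ Suc n" for u :: real
  by (simp only: exp_of_nat_mult[symmetric] mult_minus_left mult_minus_right)

lemma exp_Suc_sums:
  assumes "0 < u"
  shows "(\<lambda>n. exp (- real (Suc n) * u)) sums (1 / (exp u - 1))"
proof -
  have "(\<lambda>n. exp (- u) * exp (- u) ^ n) sums (exp (- u) * (1 / (1 - exp (- u))))"
    using assms by (intro sums_mult geometric_sums) auto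
  moreover have "exp (- u) * exp (- u) ^ n = exp (- real (Suc n) * u)" for n
    unfolding exp_Suc_mult by simp
  moreover have "exp (- u) * (1 / (1 - exp (- u))) = 1 / (exp u - 1)"
    using assms by (simp add: exp_minus field_simps)
  ultimately show ?thesis by simp
qed

lemma runs_ge:
  assumes "0 \<le> q" "0 < u"
  shows "1 / (exp u - 1) \<le> runs q u"
proof -
  note s = exp_Suc_sums[OF assms(2)]
  have "1 / (exp u - 1) = (\<Sum>n. exp (- real (Suc n) * u))"
    using s by (simp only: sums_iff)
  also have "\<dots> \<le> runs q u"
    unfolding runs_def
  proof (rule suminf_le)
    show "exp (- real (Suc n) * u) \<le> run n q * exp (- real (Suc n) * u)" for n
      using run_ge_1[OF assms(1), of n] by simp
    show "summable (\<lambda>n. exp (- real (Suc n) * u))" using s by (simp only: sums_iff)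
    show "summable (\<lambda>n. run n q * exp (- real (Suc n) * u))"
      by (rule runs_line_derivative(2)[OF runs_dom_pos[OF assms(2)]])
  qed
  finally show ?thesis .
qed

lemma runs_le:
  assumes "0 < u"
  shows "runs q u \<le> 2 * 2 powr \<bar>q\<bar> / (exp u - 1)"
proof -
  note s = sums_mult[OF exp_Suc_sums[OF assms], of "2 * 2 powr \<bar>q\<bar>"]
  have "runs q u \<le> (\<Sum>n. 2 * 2 powr \<bar>q\<bar> * exp (- real (Suc n) * u))"
    unfolding runs_def
  proof (rule suminf_le)
    show "run n q * exp (- real (Suc n) * u) \<le> 2 * 2 powr \<bar>q\<bar> * exp (- real (Suc n) * u)" for n
      using run_le[of n q] by (intro mult_right_mono) auto
    show "summable (\<lambda>n. 2 * 2 powr \<bar>q\<bar> * exp (- real (Suc n) * u))" using s by (simp only: sums_iff)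
    show "summable (\<lambda>n. run n q * exp (- real (Suc n) * u))"
      by (rule runs_line_derivative(2)[OF runs_dom_pos[OF assms]])
  qed
  also have "\<dots> = 2 * 2 powr \<bar>q\<bar> / (exp u - 1)" using s by (simp add: sums_iff del: of_nat_Suc)
  finally show ?thesis .
qed

text \<open>The assumptions say that \<open>T q\<close> is the infimum of all \<open>u > 0\<close> with \<open>\<rho> q * runs q u \<le> 1\<close>. So
  either \<open>T q = 0\<close>, or \<open>T q\<close> is the positive solution \<open>u\<close> of \<open>\<rho> q * runs q u = 1\<close>.\<close>

locale phase =
  fixes \<rho> \<rho>' T :: "real \<Rightarrow> real"
  assumes \<rho>_pos: "0 < \<rho> q"
    and \<rho>_deriv: "(\<rho> has_field_derivative \<rho>' q) (at q)"
    and T_le: "0 < u \<Longrightarrow> \<rho> q * runs q u \<le> 1 \<Longrightarrow> T q \<le> u"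
    and T_ge: "0 < u \<Longrightarrow> 1 < \<rho> q * runs q u \<Longrightarrow> u \<le> T q"
    and T_nonneg: "0 \<le> T q"
begin

lemma line:
  assumes "runs_dom q u"
  shows "((\<lambda>e. \<rho> (q + d * e) * runs (q + d * e) (u + c * e)) has_field_derivative
      d * (\<rho>' q * runs q u + \<rho> q * runs_q q u) - c * (\<rho> q * runs_u q u)) (at 0)"
proof -
  have "((\<lambda>e. \<rho> (q + d * e)) has_field_derivative \<rho>' (q + d * 0) * d) (at 0)"
    by (rule DERIV_chain2[OF \<rho>_deriv]) (auto intro!: derivative_eq_intros)
  from DERIV_mult[OF this runs_line_derivative(1)[OF assms, of d c]]
  show ?thesis by (simp add: algebra_simps)
qed

lemma Q_pos: "runs_dom q u \<Longrightarrow> 0 < \<rho> q * runs_u q u"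
  by (simp add: \<rho>_pos runs_u_pos)

lemma T_eq:
  assumes u: "0 < u" and eq: "\<rho> q * runs q u = 1"
  shows "T q = u"
proof (rule antisym)
  show "T q \<le> u" using T_le[OF u, of q] eq by simp
  have dom: "runs_dom q u" using u by (rule runs_dom_pos)
  from line[OF dom, of 0 1] have "((\<lambda>e. \<rho> q * runs q (u + e)) has_field_derivative
      - (\<rho> q * runs_u q u)) (at 0)" by simp
  from DERIV_neg_dec_left[OF this] Q_pos[OF dom] eq
  obtain d where d: "0 < d" "\<And>h. 0 < h \<Longrightarrow> h < d \<Longrightarrow> 1 < \<rho> q * runs q (u - h)" by auto
  show "u \<le> T q"
  proof (rule field_le_epsilon)
    fix e :: real assume e: "0 < e"
    define h where "h = min e (min d u) / 2"
    have h: "0 < h" "h < d" "h < u" "h \<le> e" using e d u by (auto simp: h_def)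
    have "u - h \<le> T q" using T_ge[of "u - h" q] d(2)[OF h(1,2)] h by simp
    then show "u \<le> T q + e" using h by simp
  qed
qed

lemma T_eq_0:
  assumes q: "q < -1" and eq: "\<rho> q * runs q 0 = 1"
  shows "T q = 0"
proof (rule antisym[OF _ T_nonneg])
  have dom: "runs_dom q 0" using q by (rule runs_dom_neg)
  from line[OF dom, of 0 1] have "((\<lambda>e. \<rho> q * runs q e) has_field_derivative
      - (\<rho> q * runs_u q 0)) (at 0)" by simp
  from DERIV_neg_dec_right[OF this] Q_pos[OF dom] eq
  obtain d where d: "0 < d" "\<And>h. 0 < h \<Longrightarrow> h < d \<Longrightarrow> \<rho> q * runs q h < 1" by auto
  show "T q \<le> 0"
  proof (rule field_le_epsilon)
    fix e :: real assume e: "0 < e"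
    define h where "h = min e d / 2"
    have h: "0 < h" "h < d" "h \<le> e" using e d by (auto simp: h_def)
    have "T q \<le> h" using T_le[of h q] d(2)[OF h(1,2)] h by simp
    then show "T q \<le> 0 + e" using h by simp
  qed
qed

lemma root_exists:
  assumes "0 \<le> q"
  shows "\<exists>u>0. \<rho> q * runs q u = 1"
proof -
  define K :: real where "K = 2 * 2 powr \<bar>q\<bar>"
  have K: "1 \<le> K" using ge_one_powr_ge_zero[of 2 "\<bar>q\<bar>"] by (simp add: K_def)
  define v where "v = ln (1 + \<rho> q)"
  define w where "w = ln (1 + K * \<rho> q)"
  have e: "exp v = 1 + \<rho> q" "exp w = 1 + K * \<rho> q"
    using \<rho>_pos[of q] K by (simp_all add: v_def w_def add_pos_pos)
  have "\<rho> q \<le> K * \<rho> q" using K \<rho>_pos[of q] by simp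
  then have vw: "0 < v" "v \<le> w"
    unfolding v_def w_def using \<rho>_pos[of q] by (auto intro!: ln_mono)
  have "1 / \<rho> q \<le> runs q v" using runs_ge[OF assms vw(1)] e by simp
  then have 1: "1 \<le> \<rho> q * runs q v" using \<rho>_pos[of q] by (simp add: field_simps)
  have "runs q w \<le> K / (K * \<rho> q)" using runs_le[of w q] vw e by (simp add: K_def)
  then have 2: "\<rho> q * runs q w \<le> 1" using \<rho>_pos[of q] K by (simp add: field_simps)
  have "isCont (\<lambda>u. \<rho> q * runs q u) u" if "0 < u" for u
  proof -
    from line[OF runs_dom_pos[OF that, of q], of 0 1] have "((\<lambda>e. \<rho> q * runs q (u + e)) has_field_derivative
      - (\<rho> q * runs_u q u)) (at 0)" by simp
    then have "((\<lambda>x. \<rho> q * runs q x) has_field_derivative - (\<rho> q * runs_u q u)) (at (0 + u))"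
      by (subst DERIV_shift) (simp add: add.commute)
    then show ?thesis by (auto dest: DERIV_isCont)
  qed
  then have "\<exists>u\<ge>v. u \<le> w \<and> \<rho> q * runs q u = 1"
    using 1 2 vw by (intro IVT2) auto
  then show ?thesis using vw(1) by (meson less_le_trans)
qed

text \<open>An implicit function argument that needs derivatives along lines only: lines through \<open>(q, u)\<close>
  with slope slightly above or below \<open>P / Q\<close> bound \<open>T\<close> from above and from below.\<close>

lemma differentiable_nonneg:
  assumes "0 \<le> q"
  shows "T differentiable (at q)"
proof -
  obtain u where u: "0 < u" and eq: "\<rho> q * runs q u = 1"
    using root_exists[OF assms] by blast
  have Tq: "T q = u" using u eq by (rule T_eq)
  have dom: "runs_dom q u" using u by (rule runs_dom_pos)
  define P where "P = \<rho>' q * runs q u + \<rho> q * runs_q q u"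
  define Q where "Q = \<rho> q * runs_u q u"
  have Q: "0 < Q" unfolding Q_def by (rule Q_pos[OF dom])
  define \<phi> where "\<phi> c e = \<rho> (q + e) * runs (q + e) (u + c * e)" for c e
  have \<phi>: "(\<phi> c has_field_derivative P - c * Q) (at 0)" for c
    using line[OF dom, of 1 c] unfolding P_def Q_def \<phi>_def by simp
  have \<phi>0: "\<phi> c 0 = 1" for c by (simp add: \<phi>_def eq)
  define c0 where "c0 = P / Q"
  have "(T has_field_derivative c0) (at q)"
    unfolding DERIV_def
  proof (rule LIM_I)
    fix r :: real assume r: "0 < r"
    define \<eta> where "\<eta> = r / 2"
    have \<eta>: "0 < \<eta>" "\<eta> < r" using r by (auto simp: \<eta>_def)
    have neg: "P - (c0 + \<eta>) * Q < 0" and pos: "0 < P - (c0 - \<eta>) * Q"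
      using Q \<eta> by (simp_all add: c0_def field_simps)
    obtain d1 where d1: "0 < d1" "\<And>h. 0 < h \<Longrightarrow> h < d1 \<Longrightarrow> \<phi> (c0 + \<eta>) h < 1"
      using DERIV_neg_dec_right[OF \<phi> neg] by (auto simp: \<phi>0)
    obtain d2 where d2: "0 < d2" "\<And>h. 0 < h \<Longrightarrow> h < d2 \<Longrightarrow> 1 < \<phi> (c0 + \<eta>) (- h)"
      using DERIV_neg_dec_left[OF \<phi> neg] by (auto simp: \<phi>0)
    obtain d3 where d3: "0 < d3" "\<And>h. 0 < h \<Longrightarrow> h < d3 \<Longrightarrow> 1 < \<phi> (c0 - \<eta>) h"
      using DERIV_pos_inc_right[OF \<phi> pos] by (auto simp: \<phi>0)
    obtain d4 where d4: "0 < d4" "\<And>h. 0 < h \<Longrightarrow> h < d4 \<Longrightarrow> \<phi> (c0 - \<eta>) (- h) < 1"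
      using DERIV_pos_inc_left[OF \<phi> pos] by (auto simp: \<phi>0)
    define C where "C = \<bar>c0\<bar> + \<eta> + 1"
    have C: "0 < C" using \<eta> by (simp add: C_def)
    define d where "d = min (min d1 d2) (min (min d3 d4) (u / C))"
    have d: "0 < d" using d1 d2 d3 d4 u C by (simp add: d_def)
    have pos_u: "0 < u + c * e" if "\<bar>c\<bar> \<le> C" "\<bar>e\<bar> < d" for c e
    proof -
      have "\<bar>c * e\<bar> \<le> C * \<bar>e\<bar>" using that by (simp add: abs_mult mult_right_mono)
      also have "\<dots> < C * (u / C)" using that C by (intro mult_strict_left_mono) (auto simp: d_def)
      finally show ?thesis using C by (simp add: abs_if split: if_splits)
    qed
    have C': "\<bar>c0 + \<eta>\<bar> \<le> C" "\<bar>c0 - \<eta>\<bar> \<le> C" using \<eta> by (auto simp: C_def)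
    show "\<exists>s>0. \<forall>x. x \<noteq> 0 \<and> norm (x - 0) < s \<longrightarrow> norm ((T (q + x) - T q) / x - c0) < r"
    proof (intro exI[of _ d] conjI d allI impI)
      fix x :: real assume "x \<noteq> 0 \<and> norm (x - 0) < d"
      then have x: "x \<noteq> 0" "\<bar>x\<bar> < d" by auto
      have xd: "\<bar>x\<bar> < d1" "\<bar>x\<bar> < d2" "\<bar>x\<bar> < d3" "\<bar>x\<bar> < d4" using x by (auto simp: d_def)
      have "\<bar>(T (q + x) - T q) / x - c0\<bar> \<le> \<eta>"
      proof (cases "0 < x")
        case True
        have "T (q + x) \<le> u + (c0 + \<eta>) * x"
          using T_le[OF pos_u[OF C'(1) x(2)], of "q + x"] d1(2)[of x] True xd by (simp add: \<phi>_def)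
        moreover have "u + (c0 - \<eta>) * x \<le> T (q + x)"
          using T_ge[OF pos_u[OF C'(2) x(2)], of "q + x"] d3(2)[of x] True xd by (simp add: \<phi>_def)
        ultimately have "(T (q + x) - u) / x \<le> c0 + \<eta>" "c0 - \<eta> \<le> (T (q + x) - u) / x"
          using True by (simp_all add: field_simps)
        then show ?thesis unfolding Tq by linarith
      next
        case False
        then have neg: "x < 0" using x by simp
        have "T (q + x) \<le> u + (c0 - \<eta>) * x"
          using T_le[OF pos_u[OF C'(2) x(2)], of "q + x"] d4(2)[of "- x"] neg xd by (simp add: \<phi>_def)
        moreover have "u + (c0 + \<eta>) * x \<le> T (q + x)"
          using T_ge[OF pos_u[OF C'(1) x(2)], of "q + x"] d2(2)[of "- x"] neg xd by (simp add: \<phi>_def)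
        ultimately have "(T (q + x) - u) / x \<le> c0 + \<eta>" "c0 - \<eta> \<le> (T (q + x) - u) / x"
          using neg by (simp_all add: field_simps)
        then show ?thesis unfolding Tq by linarith
      qed
      then show "norm ((T (q + x) - T q) / x - c0) < r" using \<eta> by simp
    qed
  qed
  then show ?thesis using real_differentiable_def by blast
qed

text \<open>At a transversal crossing \<open>T\<close> has a minimum with value \<open>0\<close>, but on one side it lies above a
  line of non-zero slope.\<close>

lemma not_differentiable:
  assumes q: "q < -1" and eq: "\<rho> q * runs q 0 = 1"
    and P: "\<rho>' q * runs q 0 + \<rho> q * runs_q q 0 \<noteq> 0"
  shows "\<not> T differentiable (at q)"
proof
  assume "T differentiable (at q)"
  then obtain t where t: "(T has_field_derivative t) (at q)"
    by (auto simp: real_differentiable_def)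
  have Tq: "T q = 0" using q eq by (rule T_eq_0)
  have "t = 0"
    by (rule DERIV_local_min[OF t, of 1]) (auto simp: Tq T_nonneg)
  have dom: "runs_dom q 0" using q by (rule runs_dom_neg)
  define P where "P = \<rho>' q * runs q 0 + \<rho> q * runs_q q 0"
  define Q where "Q = \<rho> q * runs_u q 0"
  have Q: "0 < Q" unfolding Q_def by (rule Q_pos[OF dom])
  define c where "c = P / (2 * Q)"
  define \<phi> where "\<phi> e = \<rho> (q + e) * runs (q + e) (c * e)" for e
  have \<phi>: "(\<phi> has_field_derivative P / 2) (at 0)"
  proof -
    have e: "P - c * Q = P / 2" using Q by (simp add: c_def field_simps)
    have "(\<phi> has_field_derivative P - c * Q) (at 0)"
      using line[OF dom, of 1 c] unfolding P_def[symmetric] Q_def[symmetric] \<phi>_def by simp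
    then show ?thesis unfolding e .
  qed
  have \<phi>0: "\<phi> 0 = 1" by (simp add: \<phi>_def eq)
  have D: "((\<lambda>x. T x - c * x) has_field_derivative - c) (at q)"
    using t \<open>t = 0\<close> by (auto intro!: derivative_eq_intros)
  show False
  proof (cases "0 < P")
    case True
    then have c: "0 < c" using Q by (simp add: c_def)
    obtain d1 where d1: "0 < d1" "\<And>h. 0 < h \<Longrightarrow> h < d1 \<Longrightarrow> 1 < \<phi> h"
      using DERIV_pos_inc_right[OF \<phi>] True by (auto simp: \<phi>0)
    obtain d2 where d2: "0 < d2" "\<And>h. 0 < h \<Longrightarrow> h < d2 \<Longrightarrow> T (q + h) - c * (q + h) < - c * q"
      using DERIV_neg_dec_right[OF D] c by (auto simp: Tq)
    define h where "h = min d1 d2 / 2"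
    have h: "0 < h" "h < d1" "h < d2" using d1 d2 by (auto simp: h_def)
    have "c * h \<le> T (q + h)" using T_ge[of "c * h" "q + h"] d1(2)[OF h(1,2)] c h by (simp add: \<phi>_def)
    then show False using d2(2)[OF h(1,3)] by (simp add: algebra_simps)
  next
    case False
    then have "P < 0" using assms(3) by (simp add: P_def)
    then have c: "c < 0" using Q by (simp add: c_def divide_neg_pos)
    obtain d1 where d1: "0 < d1" "\<And>h. 0 < h \<Longrightarrow> h < d1 \<Longrightarrow> 1 < \<phi> (- h)"
      using DERIV_neg_dec_left[OF \<phi>] \<open>P < 0\<close> by (auto simp: \<phi>0)
    obtain d2 where d2: "0 < d2" "\<And>h. 0 < h \<Longrightarrow> h < d2 \<Longrightarrow> T (q - h) - c * (q - h) < - c * q"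
      using DERIV_pos_inc_left[OF D] c by (auto simp: Tq)
    define h where "h = min d1 d2 / 2"
    have h: "0 < h" "h < d1" "h < d2" using d1 d2 by (auto simp: h_def)
    have "c * (- h) \<le> T (q - h)"
      using T_ge[of "c * (- h)" "q - h"] d1(2)[OF h(1,2)] mult_neg_pos[OF c h(1)]
      by (simp add: \<phi>_def)
    then show False using d2(2)[OF h(1,3)] by (simp add: algebra_simps)
  qed
qed

end

section \<open>The spectrum of a measure with paired weights\<close>

context paired_weights
begin

text \<open>The growth rate of the part of the partition sum that belongs to addresses with all digits in
  \<open>D\<close>.\<close>

definition growth :: "real \<Rightarrow> real" where
  "growth q = diag_sum q * (1 + 4 powr q)"

text \<open>The weight of a digit outside \<open>D\<close> relative to \<^const>\<open>growth\<close>.\<close>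

definition mixing :: "real \<Rightarrow> real" where
  "mixing q = full_sum q / growth q"

text \<open>The spectrum times \<open>ln (2 * m)\<close>, up to a smooth summand: the logarithmic growth rate of the partition sums minus that
  of its part with all digits in \<open>D\<close>.\<close>

definition excess :: "real \<Rightarrow> real" where
  "excess q = Lq_spectrum (2 * m) \<mu> q * ln (real (2 * m)) - ln (growth q)"

lemma growth_pos: "0 < growth q"
  using diag_sum_pos one_plus_powr_pos by (simp add: growth_def)

lemma moment_pure: "diag_sum q ^ k * pair_sum q k 1 0 = growth q ^ k"
  by (simp add: growth_def pair_sum_single power_mult_distrib)

lemma moment_mixed:
  "moment q n 1 1 = diag_sum q ^ n * pair_sum q n 1 1 +
    full_sum q * (\<Sum>k<n. (diag_sum q ^ k * pair_sum q k 1 1) * moment q (n - 1 - k) 1 1)"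
  by (subst moment_renewal) (simp add: sum_distrib_left mult_ac)

lemma moment_first:
  "moment q n 1 0 = growth q ^ n + full_sum q * (\<Sum>k<n. growth q ^ k * moment q (n - 1 - k) 1 1)"
proof -
  have "diag_sum q ^ k * pair_sum q k 1 0 * full_sum q * x = full_sum q * (growth q ^ k * x)" for k x
    by (simp add: moment_pure[symmetric])
  then show ?thesis
    by (subst moment_renewal) (simp only: moment_pure sum_distrib_left)
qed

lemma moment_first_ge: "growth q ^ n \<le> moment q n 1 0"
proof -
  have "0 \<le> moment q k 1 1" for k
    unfolding moment_def by (intro sum_nonneg) simp
  then show ?thesis
    unfolding moment_first using growth_pos[of q] full_sum_pos[of q]
    by (simp add: sum_nonneg less_imp_le)
qed

lemma renewal_series:
  assumes "runs_dom q u"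
  shows "(\<lambda>k. diag_sum q ^ k * pair_sum q k 1 1 / (growth q * exp u) ^ Suc k) sums (runs q u / growth q)"
proof -
  have "diag_sum q ^ k * pair_sum q k 1 1 / (growth q * exp u) ^ Suc k =
      run k q * exp (- real (Suc k) * u) / growth q" for k
  proof -
    have e: "exp (- real (Suc k) * u) = 1 / exp u ^ Suc k"
      by (simp only: mult_minus_left exp_minus exp_of_nat_mult inverse_eq_divide)
    have g: "(growth q * exp u) ^ Suc k = growth q * (diag_sum q ^ k * (1 + 4 powr q) ^ k) * exp u ^ Suc k"
      by (simp add: growth_def power_mult_distrib)
    have "A * B / (G * (A * Y) * X) = B / Y * (1 / X) / G" if "A \<noteq> 0" for A B G X Y :: real
      using that by (simp add: mult_ac)
    then show ?thesis unfolding g e run_def using diag_sum_pos[of q] by simp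
  qed
  moreover have "(\<lambda>k. run k q * exp (- real (Suc k) * u) / growth q) sums (runs q u / growth q)"
    unfolding runs_def by (intro sums_divide summable_sums runs_line_derivative(2)[OF assms])
  ultimately show ?thesis by simp
qed

lemma first_upper:
  assumes u: "0 < u" and le: "mixing q * runs q u \<le> 1"
  shows "\<exists>C. \<forall>n. moment q n 1 0 \<le> C * (growth q * exp u) ^ n"
proof (rule renewal_upper[where g="full_sum q" and \<alpha>="growth q" and W="\<lambda>n. moment q n 1 1"
      and B="\<lambda>k. diag_sum q ^ k * pair_sum q k 1 1"])
  note s = renewal_series[OF runs_dom_pos[OF u], of q]
  show "summable (\<lambda>k. diag_sum q ^ k * pair_sum q k 1 1 / (growth q * exp u) ^ Suc k)"
    using s by (simp only: sums_iff)
  show "full_sum q * (\<Sum>k. diag_sum q ^ k * pair_sum q k 1 1 / (growth q * exp u) ^ Suc k) \<le> 1"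
    using s le unfolding mixing_def by (simp only: sums_iff) simp
  show "growth q < growth q * exp u" using u growth_pos[of q] by simp
  show "0 \<le> diag_sum q ^ k * pair_sum q k 1 1" for k
    using diag_sum_pos[of q] by (simp add: less_imp_le pair_sum_pos)
qed (rule full_sum_pos growth_pos moment_mixed moment_first)+

lemma first_lower:
  assumes u: "0 < u" and ge: "1 < mixing q * runs q u"
  shows "\<exists>c>0. \<forall>n>0. c * (growth q * exp u) ^ n \<le> moment q n 1 0"
proof (rule renewal_lower[where g="full_sum q" and \<alpha>="growth q" and W="\<lambda>n. moment q n 1 1"
      and B="\<lambda>k. diag_sum q ^ k * pair_sum q k 1 1"])
  note s = renewal_series[OF runs_dom_pos[OF u], of q]
  show "summable (\<lambda>k. diag_sum q ^ k * pair_sum q k 1 1 / (growth q * exp u) ^ Suc k)"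
    using s by (simp only: sums_iff)
  show "1 < full_sum q * (\<Sum>k. diag_sum q ^ k * pair_sum q k 1 1 / (growth q * exp u) ^ Suc k)"
    using s ge unfolding mixing_def by (simp only: sums_iff) simp
  show "0 < growth q * exp u" using growth_pos[of q] by simp
  show "0 < diag_sum q ^ k * pair_sum q k 1 1" for k
    using diag_sum_pos[of q] by (simp add: pair_sum_pos)
qed (rule full_sum_pos growth_pos moment_mixed moment_first)+

lemma mixing_pos: "0 < mixing q"
  by (simp add: mixing_def full_sum_pos growth_pos)

lemma some_upper: "\<exists>u>0. mixing q * runs q u \<le> 1"
proof -
  define K :: real where "K = 2 * 2 powr \<bar>q\<bar>"
  have K: "0 < K" by (simp add: K_def)
  define u where "u = ln (1 + K * mixing q)"
  have e: "exp u = 1 + K * mixing q" and u: "0 < u"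
    using K mixing_pos[of q] by (simp_all add: u_def add_pos_pos)
  have "runs q u \<le> K / (K * mixing q)" using runs_le[OF u, of q] e by (simp add: K_def)
  then have "mixing q * runs q u \<le> 1" using K mixing_pos[of q] by (simp add: field_simps)
  with u show ?thesis by blast
qed

lemma growth_exp: "0 < growth q * exp u" "ln (growth q * exp u) = ln (growth q) + u"
  using growth_pos[of q] by (simp_all add: ln_mult)

lemma excess_le:
  assumes "0 < u" "mixing q * runs q u \<le> 1"
  shows "excess q \<le> u"
proof -
  obtain C where "\<And>n. moment q n 1 0 \<le> C * (growth q * exp u) ^ n"
    using first_upper[OF assms] by blast
  then show ?thesis
    using Lq_spectrum_bounds(2)[OF _ partition_sum, of 1 "growth q" q "growth q * exp u" C]
      moment_first_ge[of q] growth_pos[of q] growth_exp[of q u] m2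
    by (simp add: excess_def)
qed

lemma excess_ge:
  assumes "0 < u" "1 < mixing q * runs q u"
  shows "u \<le> excess q"
proof -
  obtain c where c: "0 < c" "\<And>n. 0 < n \<Longrightarrow> c * (growth q * exp u) ^ n \<le> moment q n 1 0"
    using first_lower[OF assms] by blast
  obtain v C where "\<And>n. moment q n 1 0 \<le> C * (growth q * exp v) ^ n"
    using some_upper[of q] first_upper by meson
  then show ?thesis
    using Lq_spectrum_bounds(1)[OF _ partition_sum c(1) _ c(2), of "growth q * exp v" C]
      growth_exp[of q u] growth_exp[of q v] m2
    by (simp add: excess_def)
qed

lemma excess_nonneg: "0 \<le> excess q"
proof -
  obtain v C where "\<And>n. moment q n 1 0 \<le> C * (growth q * exp v) ^ n"
    using some_upper[of q] first_upper by meson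
  then show ?thesis
    using Lq_spectrum_bounds(1)[OF _ partition_sum, of 1 "growth q" q "growth q * exp v" C]
      moment_first_ge[of q] growth_pos[of q] growth_exp[of q v] m2
    by (simp add: excess_def)
qed

text \<open>The derivatives of \<^const>\<open>diag_sum\<close> and \<^const>\<open>full_sum\<close>.\<close>

definition diag_deriv :: "real \<Rightarrow> real" where
  "diag_deriv q = (\<Sum>j<m. if j \<in> D then a j powr q * ln (a j) else 0)"

definition full_deriv :: "real \<Rightarrow> real" where
  "full_deriv q = (\<Sum>j<m. if j \<in> D then 0 else 2 * (a j powr q * ln (a j)))"

lemma diag_has_derivative: "(diag_sum has_field_derivative diag_deriv q) (at q)"
  unfolding diag_sum_def[abs_def] diag_deriv_def
  using a_pos by (intro DERIV_sum) (auto intro!: derivative_eq_intros)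

lemma full_has_derivative: "(full_sum has_field_derivative full_deriv q) (at q)"
  unfolding full_sum_def[abs_def] full_deriv_def
  using a_pos by (intro DERIV_sum) (auto intro!: derivative_eq_intros)

text \<open>The logarithmic derivative of \<^const>\<open>mixing\<close>.\<close>

definition mixing_logderiv :: "real \<Rightarrow> real" where
  "mixing_logderiv q = full_deriv q / full_sum q - diag_deriv q / diag_sum q -
    4 powr q * ln 4 / (1 + 4 powr q)"

lemma growth_has_derivative:
  "(growth has_field_derivative
    (diag_deriv q * (1 + 4 powr q) + diag_sum q * (4 powr q * ln 4))) (at q)"
  unfolding growth_def[abs_def]
  by (rule derivative_eq_intros diag_has_derivative refl | simp)+

lemma mixing_has_derivative:
  "(mixing has_field_derivative mixing q * mixing_logderiv q) (at q)"
proof -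
  have nz: "diag_sum q \<noteq> 0" "1 + 4 powr q \<noteq> 0" "full_sum q \<noteq> 0" "growth q \<noteq> 0"
    using diag_sum_pos[of q] one_plus_powr_pos[of q] full_sum_pos[of q] growth_pos[of q] by linarith+
  have alg: "(F' * (B * Y) - F * (B' * Y + B * X)) / (B * Y * (B * Y)) =
      F / (B * Y) * (F' / F - B' / B - X / Y)"
    if "B \<noteq> 0" "Y \<noteq> 0" "F \<noteq> 0" for F F' B B' X Y :: real
    using that by (simp add: field_simps)
  have "(mixing has_field_derivative
      (full_deriv q * growth q - full_sum q * (diag_deriv q * (1 + 4 powr q) + diag_sum q * (4 powr q * ln 4))) /
      (growth q * growth q)) (at q)"
    unfolding mixing_def[abs_def]
    by (rule DERIV_divide[OF full_has_derivative growth_has_derivative nz(4)])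
  then show ?thesis
    unfolding growth_def alg[OF nz(1-3)] mixing_def mixing_logderiv_def .
qed

sublocale phase mixing "\<lambda>q. mixing q * mixing_logderiv q" excess
  by unfold_locales (rule mixing_pos mixing_has_derivative excess_le excess_ge excess_nonneg; assumption?)+

lemma Lq_spectrum_differentiable_iff:
  "Lq_spectrum (2 * m) \<mu> differentiable (at q) \<longleftrightarrow> excess differentiable (at q)"
proof -
  have lnl: "ln (real (2 * m)) \<noteq> 0" using m2 by simp
  have "((\<lambda>q. ln (growth q)) has_field_derivative
      (diag_deriv q * (1 + 4 powr q) + diag_sum q * (4 powr q * ln 4)) / growth q) (at q)"
    using DERIV_chain2[OF DERIV_ln growth_has_derivative] growth_pos[of q]
    by (auto simp: field_simps)
  then have G: "(\<lambda>q. ln (growth q)) differentiable (at q)"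
    using real_differentiable_def by blast
  have L: "Lq_spectrum (2 * m) \<mu> = (\<lambda>q. (excess q + ln (growth q)) / ln (real (2 * m)))"
    using lnl by (auto simp: excess_def)
  show ?thesis
  proof
    assume "Lq_spectrum (2 * m) \<mu> differentiable (at q)"
    then show "excess differentiable (at q)"
      unfolding excess_def[abs_def] using G by (intro derivative_intros) auto
  next
    assume "excess differentiable (at q)"
    then show "Lq_spectrum (2 * m) \<mu> differentiable (at q)"
      unfolding L using G lnl by (intro derivative_intros) auto
  qed
qed

end

section \<open>Bump sums and the choice of the weights\<close>

text \<open>The explicit constants come from the comparison of \<open>run n q\<close> with \<open>(4/5) ^ n\<close>.\<close>

lemma runs_at_0:
  assumes "q < -1"
  shows "2 powr q \<le> runs q 0" "runs q 0 \<le> 5" "\<bar>runs_q q 0\<bar> \<le> 75"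
proof -
  have dom: "runs_dom q 0" using assms by (rule runs_dom_neg)
  note sm = runs_line_derivative(2,3)[OF dom, simplified]
  have le: "run n q \<le> (4 / 5) ^ n" for n using assms by (intro run_le_geometric) simp
  have "(\<Sum>n<1. run n q) \<le> (\<Sum>n. run n q)"
    using sm(1) run_pos by (intro sum_le_suminf) (auto simp: less_imp_le)
  then show "2 powr q \<le> runs q 0" by (simp add: runs_def run_def)
  have g: "(\<lambda>n. (4 / 5 :: real) ^ n) sums 5"
    using geometric_sums[of "4 / 5 :: real"] by simp
  have "(\<Sum>n. run n q) \<le> (\<Sum>n. (4 / 5) ^ n)"
    by (rule suminf_le[OF le sm(1)]) (use g in \<open>simp add: sums_iff\<close>)
  then show "runs q 0 \<le> 5" using g by (simp add: runs_def sums_iff)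
  have g2: "(\<lambda>n. 3 * (real (Suc n) * (4 / 5) ^ n)) sums 75"
    using sums_mult[OF geometric_deriv_sums[of "4 / 5 :: real"], of 3] by (simp add: power2_eq_square)
  have le2: "\<bar>run_deriv n q\<bar> \<le> 3 * (real (Suc n) * (4 / 5) ^ n)" for n
  proof -
    have "3 * real (Suc n) * run n q \<le> 3 * real (Suc n) * (4 / 5) ^ n"
      by (intro mult_left_mono le) simp
    then show ?thesis using run_deriv_bound[of n q] unfolding mult.assoc by linarith
  qed
  have "summable (\<lambda>n. \<bar>run_deriv n q\<bar>)"
    by (rule summable_comparison_test'[where N=0 and g="\<lambda>n. 3 * (real (Suc n) * (4 / 5) ^ n)"])
      (use le2 g2 in \<open>auto simp: sums_iff simp del: of_nat_Suc\<close>)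
  then have "\<bar>\<Sum>n. run_deriv n q\<bar> \<le> (\<Sum>n. \<bar>run_deriv n q\<bar>)"
    by (rule summable_rabs)
  also have "\<dots> \<le> (\<Sum>n. 3 * (real (Suc n) * (4 / 5) ^ n))"
    by (rule suminf_le[OF le2 \<open>summable (\<lambda>n. \<bar>run_deriv n q\<bar>)\<close>])
      (use g2 in \<open>simp add: sums_iff del: of_nat_Suc\<close>)
  also have "\<dots> = 75" using g2 by (simp only: sums_iff)
  finally show "\<bar>runs_q q 0\<bar> \<le> 75" by (simp add: runs_q_def)
qed

text \<open>Up to a common factor, \<open>bump L q k\<close> is the contribution to \<^term>\<open>paired_weights.diag_sum\<close>
  or \<^term>\<open>paired_weights.full_sum\<close> of all weights of level \<open>k\<close>. It peaks sharply at \<open>q = -k\<close>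
  when \<open>L\<close> is large.\<close>

definition bump :: "nat \<Rightarrow> real \<Rightarrow> nat \<Rightarrow> real" where
  "bump L q k = 2 powr (- (2 * real L * (q + real k)\<^sup>2))"

lemma bump_pos: "0 < bump L q k"
  by (simp add: bump_def)

lemma bump_ratio:
  assumes "1 / 2 \<le> (q + real j)\<^sup>2 - (q + real i)\<^sup>2"
  shows "bump L q j \<le> 2 powr (- real L) * bump L q i"
proof -
  have "real L \<le> 2 * real L * ((q + real j)\<^sup>2 - (q + real i)\<^sup>2)"
    using mult_left_mono[OF assms, of "2 * real L"] by simp
  then have "- (2 * real L * (q + real j)\<^sup>2) \<le> - real L + - (2 * real L * (q + real i)\<^sup>2)"
    by (simp add: algebra_simps)
  then show ?thesis unfolding bump_def by (subst powr_add[symmetric]) (rule powr_mono, auto)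
qed

text \<open>The levels up to \<open>K\<close>, even ones for \<open>e = True\<close> and odd ones for \<open>e = False\<close>.\<close>

definition parity_class :: "nat \<Rightarrow> bool \<Rightarrow> nat set" where
  "parity_class K e = {k. k \<le> K \<and> even k = e}"

lemma parity_class: "finite (parity_class K e)" "card (parity_class K e) \<le> K + 1"
proof -
  have "parity_class K e \<subseteq> {..K}" by (auto simp: parity_class_def)
  then show "finite (parity_class K e)" "card (parity_class K e) \<le> K + 1"
    using card_mono[of "{..K}" "parity_class K e"] by (auto intro: finite_subset)
qed

text \<open>The sum of all bumps of one parity.\<close>

definition bumps :: "nat \<Rightarrow> nat \<Rightarrow> bool \<Rightarrow> real \<Rightarrow> real" where
  "bumps L K e q = (\<Sum>k\<in>parity_class K e. bump L q k)"

text \<open>The mean of the level with respect to the bumps of one parity. It carries the logarithmic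
  derivative of the corresponding sum of powers of the weights.\<close>

definition bump_mean :: "nat \<Rightarrow> nat \<Rightarrow> bool \<Rightarrow> real \<Rightarrow> real" where
  "bump_mean L K e q = (\<Sum>k\<in>parity_class K e. bump L q k * real k) / bumps L K e q"

lemma bumps_ge: "i \<in> parity_class K e \<Longrightarrow> bump L q i \<le> bumps L K e q"
  unfolding bumps_def using parity_class bump_pos by (intro member_le_sum) (auto simp: less_imp_le)

text \<open>If one level is nearer to \<open>-q\<close> than every level of the other parity, its class dominates.\<close>

lemma bumps_dominated:
  assumes "i \<in> parity_class K (\<not> e)"
    and "\<And>j. j \<in> parity_class K e \<Longrightarrow> 1 / 2 \<le> (q + real j)\<^sup>2 - (q + real i)\<^sup>2"
  shows "bumps L K e q \<le> (real K + 1) * 2 powr (- real L) * bumps L K (\<not> e) q"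
proof -
  have "bumps L K e q \<le> (\<Sum>j\<in>parity_class K e. 2 powr (- real L) * bump L q i)"
    unfolding bumps_def using assms by (intro sum_mono bump_ratio)
  also have "\<dots> = real (card (parity_class K e)) * (2 powr (- real L) * bump L q i)" by simp
  also have "\<dots> \<le> (real K + 1) * (2 powr (- real L) * bumps L K (\<not> e) q)"
    using parity_class(2)[of K e] bumps_ge[OF assms(1), of L q] bump_pos[of L q i]
    by (intro mult_mono) auto
  finally show ?thesis by (simp add: mult.assoc)
qed

lemma bump_mean_near:
  assumes i: "i \<in> parity_class K e"
    and far: "\<And>j. j \<in> parity_class K e \<Longrightarrow> j \<noteq> i \<Longrightarrow> 1 / 2 \<le> (q + real j)\<^sup>2 - (q + real i)\<^sup>2"
  shows "\<bar>bump_mean L K e q - real i\<bar> \<le> real K * (real K + 1) * 2 powr (- real L)"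
proof -
  let ?A = "parity_class K e" and ?S = "bumps L K e q" and ?\<delta> = "2 powr (- real L) :: real"
  have S: "0 < ?S" using bumps_ge[OF i, of L q] bump_pos[of L q i] by linarith
  have "bump_mean L K e q - real i = (\<Sum>j\<in>?A. bump L q j * (real j - real i)) / ?S"
    using S by (simp add: bump_mean_def right_diff_distrib sum_subtractf diff_divide_distrib
        bumps_def sum_distrib_right[symmetric])
  moreover have "\<bar>\<Sum>j\<in>?A. bump L q j * (real j - real i)\<bar> \<le> (\<Sum>j\<in>?A. real K * (?\<delta> * bump L q i))"
  proof (rule order_trans[OF sum_abs], rule sum_mono)
    fix j assume j: "j \<in> ?A"
    show "\<bar>bump L q j * (real j - real i)\<bar> \<le> real K * (?\<delta> * bump L q i)"
    proof (cases "j = i")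
      case False
      have "\<bar>real j - real i\<bar> \<le> real K" using i j by (auto simp: parity_class_def)
      moreover have "bump L q j \<le> ?\<delta> * bump L q i" using bump_ratio far[OF j False] by blast
      ultimately have "bump L q j * \<bar>real j - real i\<bar> \<le> (?\<delta> * bump L q i) * real K"
        using bump_pos[of L q i] by (intro mult_mono) auto
      then show ?thesis using bump_pos[of L q j] by (simp add: abs_mult mult.commute)
    qed (use bump_pos[of L q i] in simp)
  qed
  moreover have "(\<Sum>j\<in>?A. real K * (?\<delta> * bump L q i)) \<le> real K * (real K + 1) * ?\<delta> * ?S"
  proof -
    have "(\<Sum>j\<in>?A. real K * (?\<delta> * bump L q i)) = real (card ?A) * (real K * (?\<delta> * bump L q i))" by simp
    also have "\<dots> \<le> (real K + 1) * (real K * (?\<delta> * ?S))"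
      using parity_class(2)[of K e] bumps_ge[OF i, of L q] bump_pos[of L q i]
      by (intro mult_mono) auto
    finally show ?thesis by (simp add: mult_ac)
  qed
  ultimately show ?thesis using S by (simp add: abs_divide divide_le_eq)
qed

text \<open>Squared distances of \<open>t\<close> to the integers: at \<open>k + 1/4\<close> the integer \<open>k\<close> is much nearer than all
  others, at \<open>k + 3/4\<close> the integer \<open>k + 1\<close> is, and in between these two beat all the rest.\<close>

lemma far_quarter:
  assumes "j \<noteq> (k::nat)" "t = real k + 1 / 4"
  shows "1 / 2 \<le> (- t + real j)\<^sup>2 - (- t + real k)\<^sup>2"
proof -
  consider "real j \<le> real k - 1" | "real k + 1 \<le> real j" using assms(1) by linarith
  then have "(3 / 4)\<^sup>2 \<le> (real j - t)\<^sup>2"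
  proof cases
    case 1
    then have "(3 / 4)\<^sup>2 \<le> (t - real j)\<^sup>2" using assms(2) by (intro power_mono) auto
    then show ?thesis by (simp add: power2_commute)
  next
    case 2
    then show ?thesis using assms(2) by (intro power_mono) auto
  qed
  moreover have "(- t + real k)\<^sup>2 = 1 / 16" by (simp add: assms(2) power2_eq_square)
  ultimately show ?thesis by (simp add: power2_eq_square)
qed

lemma far_three_quarters:
  assumes "j \<noteq> k + 1" "t = real k + 3 / 4"
  shows "1 / 2 \<le> (- t + real j)\<^sup>2 - (- t + real (k + 1))\<^sup>2"
proof -
  consider "real j \<le> real k" | "real k + 2 \<le> real j" using assms(1) by linarith
  then have "(3 / 4)\<^sup>2 \<le> (real j - t)\<^sup>2"
  proof cases
    case 1
    then have "(3 / 4)\<^sup>2 \<le> (t - real j)\<^sup>2" using assms(2) by (intro power_mono) auto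
    then show ?thesis by (simp add: power2_commute)
  next
    case 2
    then show ?thesis using assms(2) by (intro power_mono) auto
  qed
  moreover have "(- t + real (k + 1))\<^sup>2 = 1 / 16" by (simp add: assms(2) power2_eq_square)
  ultimately show ?thesis by (simp add: power2_eq_square)
qed

lemma far_middle:
  assumes "j \<noteq> k" "j \<noteq> k + 1" "i = k \<or> i = k + 1" "real k + 1 / 4 \<le> t" "t \<le> real k + 3 / 4"
  shows "1 / 2 \<le> (- t + real j)\<^sup>2 - (- t + real i)\<^sup>2"
proof -
  consider "real j \<le> real k - 1" | "real k + 2 \<le> real j" using assms(1,2) by linarith
  then have "(5 / 4)\<^sup>2 \<le> (real j - t)\<^sup>2"
  proof cases
    case 1
    then have "(5 / 4)\<^sup>2 \<le> (t - real j)\<^sup>2" using assms by (intro power_mono) auto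
    then show ?thesis by (simp add: power2_commute)
  next
    case 2
    then show ?thesis using assms by (intro power_mono) auto
  qed
  moreover have "\<bar>- t + real i\<bar> \<le> 3 / 4" using assms by auto
  then have "(- t + real i)\<^sup>2 \<le> (3 / 4)\<^sup>2" by (rule power2_le_iff_abs_le[THEN iffD2, rotated]) simp
  ultimately show ?thesis by (simp add: power2_eq_square)
qed

text \<open>Level \<open>k\<close> consists of \<open>2 ^ (2 L (K\<^sup>2 - k\<^sup>2))\<close> copies of a weight proportional to
  \<open>2 powr (- 4 L k)\<close>; the odd levels are put into \<open>D\<close>. Completing the square in the exponent turns
  the \<open>q\<close>-th powers of level \<open>k\<close> into \<open>bump L q k\<close> times a factor that does not depend on \<open>k\<close>. The
  common normalising factor \<open>\<kappa>\<close> only enters through \<open>x = ln \<kappa>\<close>.\<close>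

lemma bump_weights:
  assumes K: "1 \<le> K"
  shows "\<exists>m D a. paired_weights m D a \<and> (\<exists>x. \<forall>q. \<exists>C>0.
    paired_weights.diag_sum m D a q = C * bumps L K False q \<and>
    paired_weights.full_sum m D a q = 2 * C * bumps L K True q \<and>
    paired_weights.diag_deriv m D a q =
      C * (\<Sum>k\<in>parity_class K False. bump L q k * (x - 4 * real L * ln 2 * real k)) \<and>
    paired_weights.full_deriv m D a q =
      2 * C * (\<Sum>k\<in>parity_class K True. bump L q k * (x - 4 * real L * ln 2 * real k)))"
proof -
  define mult where "mult k = (2::nat) ^ (2 * L * (K\<^sup>2 - k\<^sup>2))" for k
  define J where "J = (SIGMA k:{..K}. {..<mult k})"
  have finJ: "finite J" by (simp add: J_def)
  define m where "m = card J"
  obtain h where h: "bij_betw h {..<m} J"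
    using ex_bij_betw_nat_finite[OF finJ] by (auto simp: m_def atLeast0LessThan)
  have sumJ: "(\<Sum>j<m. g (fst (h j))) = (\<Sum>k\<le>K. real (mult k) * g k)" for g :: "nat \<Rightarrow> real"
  proof -
    have "(\<Sum>j<m. g (fst (h j))) = (\<Sum>x\<in>J. g (fst x))"
      using sum.reindex_bij_betw[OF h, of "\<lambda>x. g (fst x)"] .
    also have "\<dots> = (\<Sum>k\<le>K. \<Sum>i<mult k. g k)"
      unfolding J_def by (subst sum.Sigma) (auto simp: case_prod_unfold)
    finally show ?thesis by simp
  qed
  define b where "b k = (2::real) powr (- 4 * real L * real k)" for k :: nat
  define Z where "Z = (\<Sum>j<m. (if odd (fst (h j)) then 5 else 4) * b (fst (h j)))"
  define \<kappa> where "\<kappa> = 1 / Z"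
  define a where "a j = \<kappa> * b (fst (h j))" for j
  define D where "D = {j. odd (fst (h j))}"
  have bpos: "0 < b k" for k by (simp add: b_def)
  have in_J: "(k, 0) \<in> J" if "k \<le> K" for k using that by (simp add: J_def mult_def)
  have hit: "\<exists>j<m. fst (h j) = k" if "k \<le> K" for k
  proof -
    have "(k, 0) \<in> h ` {..<m}" using in_J[OF that] h by (simp add: bij_betw_def)
    then obtain j where "j < m" "h j = (k, 0)" by auto
    then show ?thesis by (intro exI[of _ j]) simp
  qed
  have m2: "2 \<le> m"
  proof -
    have "card {(0::nat, 0::nat), (1, 0)} \<le> card J"
      using in_J[of 0] in_J[of 1] K finJ by (intro card_mono) auto
    then show ?thesis by (simp add: m_def)
  qed
  have Z: "0 < Z" unfolding Z_def using m2 bpos by (intro sum_pos) (auto simp: lessThan_empty_iff)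
  have \<kappa>: "0 < \<kappa>" using Z by (simp add: \<kappa>_def)
  have pw: "paired_weights m D a"
  proof
    show "2 \<le> m" by (rule m2)
    show "0 < a j" for j using \<kappa> bpos by (simp add: a_def)
    have "(\<Sum>j<m. if j \<in> D then 5 * a j else 4 * a j) = \<kappa> * Z"
      unfolding Z_def sum_distrib_left by (intro sum.cong) (auto simp: a_def D_def)
    then show "(\<Sum>j<m. if j \<in> D then 5 * a j else 4 * a j) = 1" using Z by (simp add: \<kappa>_def)
    show "\<exists>j<m. j \<in> D" using hit[of 1] K by (auto simp: D_def)
    show "\<exists>j<m. j \<notin> D" using hit[of 0] by (auto simp: D_def)
  qed
  interpret paired_weights m D a by (rule pw)
  define x where "x = ln \<kappa>"
  have ln_b: "ln (\<kappa> * b k) = x - 4 * real L * ln 2 * real k" for k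
    using \<kappa> bpos[of k] by (simp add: ln_mult b_def x_def ln_powr)
  have "\<exists>C>0. diag_sum q = C * bumps L K False q \<and> full_sum q = 2 * C * bumps L K True q \<and>
    diag_deriv q = C * (\<Sum>k\<in>parity_class K False. bump L q k * (x - 4 * real L * ln 2 * real k)) \<and>
    full_deriv q = 2 * C * (\<Sum>k\<in>parity_class K True. bump L q k * (x - 4 * real L * ln 2 * real k))"
    for q
  proof -
    define C where "C = \<kappa> powr q * 2 powr (2 * real L * ((real K)\<^sup>2 + q\<^sup>2))"
    have C: "0 < C" using \<kappa> by (simp add: C_def)
    have copies: "real (mult k) * (\<kappa> * b k) powr q = C * bump L q k" if "k \<le> K" for k
    proof -
      have "k\<^sup>2 \<le> K\<^sup>2" using that by (intro power_mono) auto
      then have "real (mult k) = 2 powr (2 * real L * ((real K)\<^sup>2 - (real k)\<^sup>2))"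
        by (simp add: mult_def powr_realpow[symmetric] of_nat_diff)
      moreover have "(\<kappa> * b k) powr q = \<kappa> powr q * 2 powr (- 4 * real L * real k * q)"
        by (simp add: powr_mult b_def powr_powr)
      moreover have "2 * real L * ((real K)\<^sup>2 - (real k)\<^sup>2) + - 4 * real L * real k * q =
          2 * real L * ((real K)\<^sup>2 + q\<^sup>2) + - (2 * real L * (q + real k)\<^sup>2)"
        by (simp add: power2_eq_square algebra_simps)
      ultimately show ?thesis
        by (simp add: C_def bump_def powr_add[symmetric] mult_ac)
    qed
    have total: "(\<Sum>j<m. if even (fst (h j)) = e then a j powr q * g (fst (h j)) else 0) =
      C * (\<Sum>k\<in>parity_class K e. bump L q k * g k)" for e g
    proof -
      have "(\<Sum>j<m. if even (fst (h j)) = e then a j powr q * g (fst (h j)) else 0) =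
          (\<Sum>k\<le>K. real (mult k) * (if even k = e then (\<kappa> * b k) powr q * g k else 0))"
        unfolding a_def by (rule sumJ)
      also have "\<dots> = (\<Sum>k\<le>K. if even k = e then C * (bump L q k * g k) else 0)"
        by (intro sum.cong) (auto simp: mult.assoc[symmetric] copies)
      also have "\<dots> = (\<Sum>k\<in>{k \<in> {..K}. even k = e}. C * (bump L q k * g k))"
        by (rule sum.inter_filter[symmetric]) simp
      also have "{k \<in> {..K}. even k = e} = parity_class K e" by (auto simp: parity_class_def)
      finally show ?thesis by (simp add: sum_distrib_left)
    qed
    have ln_a: "ln (a j) = x - 4 * real L * ln 2 * real (fst (h j))" for j
      by (simp add: a_def ln_b)
    have inD: "j \<in> D \<longleftrightarrow> odd (fst (h j))" for j by (simp add: D_def)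
    have "diag_sum q = C * bumps L K False q"
      using total[of False "\<lambda>_. 1", unfolded mult_1_right] by (simp add: diag_sum_def inD bumps_def)
    moreover have "full_sum q = 2 * C * bumps L K True q"
    proof -
      have "full_sum q = 2 * (\<Sum>j<m. if even (fst (h j)) = True then a j powr q * 1 else 0)"
        unfolding full_sum_def sum_distrib_left by (intro sum.cong) (auto simp: D_def)
      then show ?thesis unfolding total[of True "\<lambda>_. 1"] by (simp add: bumps_def)
    qed
    moreover have "diag_deriv q =
        C * (\<Sum>k\<in>parity_class K False. bump L q k * (x - 4 * real L * ln 2 * real k))"
      using total[of False "\<lambda>k. x - 4 * real L * ln 2 * real k"]
      unfolding diag_deriv_def inD ln_a by simp
    moreover have "full_deriv q =
        2 * C * (\<Sum>k\<in>parity_class K True. bump L q k * (x - 4 * real L * ln 2 * real k))"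
    proof -
      have "full_deriv q = 2 * (\<Sum>j<m. if even (fst (h j)) = True
          then a j powr q * (x - 4 * real L * ln 2 * real (fst (h j))) else 0)"
        unfolding full_deriv_def sum_distrib_left by (intro sum.cong) (auto simp: D_def ln_a)
      then show ?thesis unfolding total[of True "\<lambda>k. x - 4 * real L * ln 2 * real k"] by simp
    qed
    ultimately show ?thesis using C by blast
  qed
  then show ?thesis using pw by blast
qed

section \<open>Phase transitions between consecutive integers\<close>

theorem mainTheorem5:
  fixes N :: nat
  assumes "N \<ge> 1"
  shows "\<exists>(l::nat) (p::nat \<Rightarrow> real). l \<ge> 2 \<and> admissible_weight l p \<and>
     (\<exists>Q \<subseteq> nondiff_points (Lq_spectrum l (self_similar_measure l p)).
        finite Q \<and> card Q = N) \<and>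
     (\<forall>q \<in> nondiff_points (Lq_spectrum l (self_similar_measure l p)). q < 0)"
proof -
  define K where "K = N + 1"
  \<comment> \<open>\<open>L\<close> must exceed the bound \<open>75 * 2 ^ K\<close> for \<open>\<bar>runs_q q 0\<bar> / runs q 0\<close> on \<open>[-K, -1)\<close>.\<close>
  define L :: nat where "L = 100 * 2 ^ K"
  define \<delta> :: real where "\<delta> = 2 powr (- real L)"
  have K1: "real K + 1 \<le> 2 ^ K"
  proof -
    have "K + 1 \<le> 2 ^ K" using less_exp[of K] by (simp add: Suc_le_eq)
    then have "real (K + 1) \<le> real (2 ^ K)" by (simp only: of_nat_le_iff)
    then show ?thesis by simp
  qed
  have \<delta>: "0 < \<delta>" "(real K + 1) * \<delta> < 2 powr (- real K) / 10"
  proof -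
    show "0 < \<delta>" by (simp add: \<delta>_def)
    have "K < 2 ^ K" by (rule less_exp)
    then have "2 * K + 4 \<le> L" unfolding L_def by linarith
    then have "real (2 * K + 4) \<le> real L" by (simp only: of_nat_le_iff)
    then have "\<delta> \<le> 2 powr (- real (2 * K + 4))" unfolding \<delta>_def by (intro powr_mono) auto
    also have "\<dots> = 2 powr (- real K) * (2 powr (- real K) / 16)"
    proof -
      have "- real (2 * K + 4) = - real K + (- real K + - 4)" by simp
      then have "2 powr (- real (2 * K + 4)) = 2 powr (- real K) * (2 powr (- real K) * 2 powr (- 4 :: real))"
        by (simp only: powr_add)
      then show ?thesis by (simp add: powr_minus)
    qed
    finally have "(real K + 1) * \<delta> \<le> 2 ^ K * (2 powr (- real K) * (2 powr (- real K) / 16))"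
      using K1 \<delta>_def by (intro mult_mono) auto
    also have "\<dots> = 2 powr (- real K) / 16" by (simp add: powr_minus powr_realpow)
    also have "\<dots> < 2 powr (- real K) / 10" by simp
    finally show "(real K + 1) * \<delta> < 2 powr (- real K) / 10" .
  qed
  have "1 \<le> K" by (simp add: K_def)
  from bump_weights[OF this, of L] obtain m D a x where pw: "paired_weights m D a"
    and ex: "\<forall>q. \<exists>C>0.
    paired_weights.diag_sum m D a q = C * bumps L K False q \<and>
    paired_weights.full_sum m D a q = 2 * C * bumps L K True q \<and>
    paired_weights.diag_deriv m D a q =
      C * (\<Sum>k\<in>parity_class K False. bump L q k * (x - 4 * real L * ln 2 * real k)) \<and>
    paired_weights.full_deriv m D a q =
      2 * C * (\<Sum>k\<in>parity_class K True. bump L q k * (x - 4 * real L * ln 2 * real k))"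
    by blast
  interpret paired_weights m D a by (rule pw)
  have bumps_pos: "0 < bumps L K e q" for e q
  proof -
    have "(if e then 0 else 1) \<in> parity_class K e" using \<open>1 \<le> K\<close> by (auto simp: parity_class_def)
    then show ?thesis using bumps_ge[of _ K e L q] bump_pos[of L q] less_le_trans by blast
  qed
  have mixing_eq: "mixing q = 2 * bumps L K True q / (bumps L K False q * (1 + 4 powr q))" for q
  proof -
    obtain C where "0 < C" "diag_sum q = C * bumps L K False q" "full_sum q = 2 * C * bumps L K True q"
      using ex by blast
    then show ?thesis by (simp add: mixing_def growth_def)
  qed
  have logderiv_eq: "mixing_logderiv q =
      4 * real L * ln 2 * (bump_mean L K False q - bump_mean L K True q) - 4 powr q * ln 4 / (1 + 4 powr q)" for q
  proof -
    obtain C where C: "0 < C" "diag_sum q = C * bumps L K False q" "full_sum q = 2 * C * bumps L K True q"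
      "diag_deriv q = C * (\<Sum>k\<in>parity_class K False. bump L q k * (x - 4 * real L * ln 2 * real k))"
      "full_deriv q = 2 * C * (\<Sum>k\<in>parity_class K True. bump L q k * (x - 4 * real L * ln 2 * real k))"
      using ex by blast
    have "(\<Sum>k\<in>parity_class K e. bump L q k * (x - 4 * real L * ln 2 * real k)) / bumps L K e q =
        x - 4 * real L * ln 2 * bump_mean L K e q" for e
    proof -
      have "(\<Sum>k\<in>parity_class K e. bump L q k * (x - 4 * real L * ln 2 * real k)) =
        bumps L K e q * x - 4 * real L * ln 2 * (\<Sum>k\<in>parity_class K e. bump L q k * real k)"
        unfolding bumps_def sum_distrib_left sum_distrib_right sum_subtractf[symmetric]
        by (intro sum.cong refl) (simp add: algebra_simps)
      then show ?thesis using bumps_pos[of e q] by (simp add: bump_mean_def diff_divide_distrib)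
    qed
    then show ?thesis using C by (simp add: mixing_logderiv_def algebra_simps)
  qed
  \<comment> \<open>The pure phase holds where \<open>r < 1\<close> and the mixed phase where \<open>r > 1\<close>.\<close>
  define r where "r q = mixing q * runs q 0" for q
  have cont: "isCont r q" if "q < -1" for q
  proof -
    from line[OF runs_dom_neg[OF that], of 1 0]
    have "((\<lambda>e. r (q + e)) has_field_derivative
        mixing q * mixing_logderiv q * runs q 0 + mixing q * runs_q q 0) (at 0)"
      by (simp add: r_def)
    then have "(r has_field_derivative
        mixing q * mixing_logderiv q * runs q 0 + mixing q * runs_q q 0) (at (0 + q))"
      by (subst DERIV_shift) (simp add: add.commute)
    then show ?thesis by (auto dest: DERIV_isCont)
  qed
  have four: "0 < 4 powr q" "4 powr q \<le> (1::real)" if "q < -1" for q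
    using that powr_mono[of q 0 "4::real"] by auto
  have r_eq: "r q = 2 * (runs q 0 * bumps L K True q) / (bumps L K False q * (1 + 4 powr q))" for q
    by (simp add: r_def mixing_eq)
  have denom: "0 < bumps L K False q * (1 + 4 powr q)" for q
    using bumps_pos one_plus_powr_pos by simp
  have even_dominates: "1 < r q"
    if q: "- real K \<le> q" "q < -1" and le: "bumps L K False q \<le> (real K + 1) * \<delta> * bumps L K True q" for q
  proof -
    have "bumps L K False q * (1 + 4 powr q) \<le> bumps L K False q * 2"
      using four[OF q(2)] bumps_pos[of False q] by (intro mult_left_mono) auto
    also have "\<dots> \<le> 2 * ((real K + 1) * \<delta> * bumps L K True q)" using le by simp
    also have "\<dots> < 2 * (2 powr (- real K) * bumps L K True q)"
    proof -
      have "2 powr (- real K) / 10 \<le> (2 powr (- real K) :: real)" by simp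
      then have "(real K + 1) * \<delta> < 2 powr (- real K)" using \<delta>(2) by linarith
      then show ?thesis using bumps_pos[of True q] by simp
    qed
    also have "\<dots> \<le> 2 * (runs q 0 * bumps L K True q)"
    proof -
      have "2 powr (- real K) \<le> (2 powr q :: real)" using q by (intro powr_mono) auto
      also have "\<dots> \<le> runs q 0" by (rule runs_at_0(1)[OF q(2)])
      finally show ?thesis using bumps_pos[of True q] by (intro mult_left_mono mult_right_mono) auto
    qed
    finally show ?thesis
      unfolding r_eq less_divide_eq_1_pos[OF denom] divide_less_eq_1_pos[OF denom] .
  qed
  have odd_dominates: "r q < 1"
    if q: "- real K \<le> q" "q < -1" and le: "bumps L K True q \<le> (real K + 1) * \<delta> * bumps L K False q" for q
  proof -
    have "2 * (runs q 0 * bumps L K True q) \<le> 2 * (5 * bumps L K True q)"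
      using runs_at_0(2)[OF q(2)] bumps_pos[of True q] by (intro mult_left_mono mult_right_mono) auto
    also have "\<dots> \<le> 10 * ((real K + 1) * \<delta> * bumps L K False q)" using le by simp
    also have "\<dots> < 1 * bumps L K False q"
    proof -
      have "2 powr (- real K) \<le> (2 powr 0 :: real)" by (intro powr_mono) auto
      then have "10 * ((real K + 1) * \<delta>) < 1" using \<delta> by simp
      then show ?thesis using bumps_pos[of False q] by (simp only: mult.assoc[symmetric] mult_less_cancel_right_pos)
    qed
    also have "\<dots> \<le> bumps L K False q * (1 + 4 powr q)"
      using four[OF q(2)] bumps_pos[of False q] by simp
    finally show ?thesis
      unfolding r_eq less_divide_eq_1_pos[OF denom] divide_less_eq_1_pos[OF denom] .
  qed
  have crossing: "\<exists>q. - (real k + 3 / 4) \<le> q \<and> q \<le> - (real k + 1 / 4) \<and> r q = 1"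
    if k: "1 \<le> k" "k \<le> N" for k
  proof -
    define s where "s = - (real k + 1 / 4)"
    define t where "t = - (real k + 3 / 4)"
    have s': "- s = real k + 1 / 4" and t': "- t = real k + 3 / 4" by (simp_all add: s_def t_def)
    have range: "- real K \<le> s" "s < -1" "- real K \<le> t" "t < -1" "t \<le> s"
      using k by (auto simp: s_def t_def K_def)
    have kin: "k \<in> parity_class K (even k)" "k + 1 \<in> parity_class K (odd k)"
      using k by (auto simp: parity_class_def K_def)
    have S: "bumps L K (odd k) s \<le> (real K + 1) * \<delta> * bumps L K (even k) s"
    proof -
      have "bumps L K (odd k) s \<le> (real K + 1) * 2 powr (- real L) * bumps L K (\<not> odd k) s"
      proof (rule bumps_dominated)
        show "k \<in> parity_class K (\<not> odd k)" using kin by simp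
        fix j assume "j \<in> parity_class K (odd k)"
        then have "j \<noteq> k" by (auto simp: parity_class_def)
        then show "1 / 2 \<le> (s + real j)\<^sup>2 - (s + real k)\<^sup>2"
          using far_quarter[of j k "- s", OF _ s'] by simp
      qed
      then show ?thesis by (simp add: \<delta>_def)
    qed
    have T: "bumps L K (even k) t \<le> (real K + 1) * \<delta> * bumps L K (odd k) t"
    proof -
      have "bumps L K (even k) t \<le> (real K + 1) * 2 powr (- real L) * bumps L K (\<not> even k) t"
      proof (rule bumps_dominated)
        show "k + 1 \<in> parity_class K (\<not> even k)" using kin by simp
        fix j assume "j \<in> parity_class K (even k)"
        then have "j \<noteq> k + 1" by (auto simp: parity_class_def)
        then show "1 / 2 \<le> (t + real j)\<^sup>2 - (t + real (k + 1))\<^sup>2"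
          using far_three_quarters[of j k "- t", OF _ t'] by simp
      qed
      then show ?thesis by (simp add: \<delta>_def)
    qed
    have c: "\<forall>q. t \<le> q \<and> q \<le> s \<longrightarrow> isCont r q" using cont range by auto
    show ?thesis
    proof (cases "even k")
      case True
      then have "1 < r s" "r t < 1"
        using even_dominates[of s] odd_dominates[of t] S T range by auto
      then show ?thesis using IVT[of r t 1 s] c range by (auto simp: s_def t_def)
    next
      case False
      then have "r s < 1" "1 < r t"
        using odd_dominates[of s] even_dominates[of t] S T range by auto
      then show ?thesis using IVT2[of r s 1 t] c range by (auto simp: s_def t_def)
    qed
  qed
  have nondiff: "\<not> excess differentiable (at q)"
    if k: "1 \<le> k" "k \<le> N" and q: "- (real k + 3 / 4) \<le> q" "q \<le> - (real k + 1 / 4)" and eq: "r q = 1" for k q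
  proof (rule not_differentiable)
    have q': "- real K \<le> q" using q k by (simp add: K_def)
    show q1: "q < -1" using q k by simp
    show "mixing q * runs q 0 = 1" using eq by (simp add: r_def)
    have small: "real K * (real K + 1) * 2 powr (- real L) \<le> 1 / 10"
    proof -
      have "real K * ((real K + 1) * \<delta>) \<le> 2 ^ K * (2 powr (- real K) / 10)"
        using K1 \<delta> by (intro mult_mono) auto
      also have "\<dots> = 1 / 10" by (simp add: powr_minus powr_realpow)
      finally show ?thesis by (simp add: \<delta>_def mult.assoc)
    qed
    have near: "\<bar>bump_mean L K (even k) q - real k\<bar> \<le> 1 / 10"
    proof (rule order_trans[OF bump_mean_near small])
      show "k \<in> parity_class K (even k)" using k by (simp add: parity_class_def K_def)
      fix j assume "j \<in> parity_class K (even k)" "j \<noteq> k"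
      then have "j \<noteq> k + 1" by (auto simp: parity_class_def)
      then show "1 / 2 \<le> (q + real j)\<^sup>2 - (q + real k)\<^sup>2"
        using far_middle[of j k k "- q"] q \<open>j \<noteq> k\<close> by simp
    qed
    have near': "\<bar>bump_mean L K (odd k) q - real (k + 1)\<bar> \<le> 1 / 10"
    proof (rule order_trans[OF bump_mean_near small])
      show "k + 1 \<in> parity_class K (odd k)" using k by (simp add: parity_class_def K_def)
      fix j assume "j \<in> parity_class K (odd k)" "j \<noteq> k + 1"
      then have "j \<noteq> k" by (auto simp: parity_class_def)
      then show "1 / 2 \<le> (q + real j)\<^sup>2 - (q + real (k + 1))\<^sup>2"
        using far_middle[of j k "k + 1" "- q"] q \<open>j \<noteq> k + 1\<close> by simp
    qed
    \<comment> \<open>The means of the two parities sit near \<open>k\<close> and \<open>k + 1\<close>, so \<open>mixing\<close> has a logarithmic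
      derivative of order \<open>L\<close>, which the bounded logarithmic derivative of \<open>runs\<close> cannot cancel.\<close>
    have gap: "1 / 2 \<le> \<bar>bump_mean L K False q - bump_mean L K True q\<bar>"
    proof (cases "even k")
      case True
      then have e: "even k = True" "odd k = False" by auto
      show ?thesis using near near' unfolding e of_nat_add of_nat_1 not_True_eq_False not_False_eq_True
        by linarith
    next
      case False
      then have e: "even k = False" "odd k = True" by auto
      show ?thesis using near near' unfolding e of_nat_add of_nat_1 not_True_eq_False not_False_eq_True
        by linarith
    qed
    have ln2: "1 / 2 \<le> ln (2::real)" using ln2_ge_two_thirds by simp
    have ln4: "4 powr q * ln 4 / (1 + 4 powr q) \<le> 2" "0 \<le> 4 powr q * ln 4 / (1 + 4 powr q)"
    proof -
      have "ln (4::real) = 2 * ln 2" using ln_realpow[of "2::real" 2] by simp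
      then have "ln (4::real) \<le> 2" using ln2_le_25_over_36 by simp
      then have "4 powr q * ln 4 \<le> 1 * (2::real)" using four[OF q1] by (intro mult_mono) auto
      then show "4 powr q * ln 4 / (1 + 4 powr q) \<le> 2"
        unfolding pos_divide_le_eq[OF one_plus_powr_pos] by (rule order_trans) simp
      show "0 \<le> 4 powr q * ln 4 / (1 + 4 powr q)" using four[OF q1] by simp
    qed
    have "real L = 4 * real L * (1 / 2) * (1 / 2)" by simp
    also have "\<dots> \<le> 4 * real L * ln 2 * \<bar>bump_mean L K False q - bump_mean L K True q\<bar>"
      using ln2 gap by (intro mult_mono mult_left_mono) auto
    also have "\<dots> = \<bar>4 * real L * ln 2 * (bump_mean L K False q - bump_mean L K True q)\<bar>"
      by (simp add: abs_mult)
    finally have big: "real L - 2 \<le> \<bar>mixing_logderiv q\<bar>"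
      unfolding logderiv_eq using ln4 by linarith
    have "2 powr (- real K) \<le> (2 powr q :: real)" using q' by (intro powr_mono) auto
    also have "\<dots> \<le> runs q 0" by (rule runs_at_0(1)[OF q1])
    finally have R: "2 powr (- real K) \<le> runs q 0" .
    have "\<bar>runs_q q 0\<bar> \<le> 75" by (rule runs_at_0(3)[OF q1])
    also have "75 < (real L - 2) * 2 powr (- real K)"
    proof -
      have "2 * 2 powr (- real K) \<le> 2 * (2 powr 0 :: real)" by (intro mult_left_mono powr_mono) auto
      moreover have "real L * 2 powr (- real K) = 100" by (simp add: L_def powr_minus powr_realpow)
      ultimately show ?thesis by (simp add: left_diff_distrib)
    qed
    also have "\<dots> \<le> \<bar>mixing_logderiv q\<bar> * runs q 0"
    proof (rule mult_mono[OF big R])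
    qed auto
    finally have "\<bar>runs_q q 0\<bar> < \<bar>mixing_logderiv q * runs q 0\<bar>"
      using less_le_trans[OF _ R, of 0] by (simp add: abs_mult)
    then have "mixing_logderiv q * runs q 0 + runs_q q 0 \<noteq> 0" by linarith
    then show "mixing q * mixing_logderiv q * runs q 0 + mixing q * runs_q q 0 \<noteq> 0"
      using mixing_pos[of q] by (simp add: mult.assoc flip: distrib_left)
  qed
  obtain z where z: "\<And>k. 1 \<le> k \<Longrightarrow> k \<le> N \<Longrightarrow>
      - (real k + 3 / 4) \<le> z k \<and> z k \<le> - (real k + 1 / 4) \<and> r (z k) = 1"
    using crossing by metis
  have inj: "inj_on z {1..N}"
  proof (rule inj_onI)
    fix i j assume i: "i \<in> {1..N}" and j: "j \<in> {1..N}" and eq: "z i = z j"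
    have "real i + 1 / 4 \<le> real j + 3 / 4" "real j + 1 / 4 \<le> real i + 3 / 4"
      using z[of i] z[of j] i j eq by auto
    then show "i = j" by linarith
  qed
  define S where "S = nondiff_points (Lq_spectrum (2 * m) \<mu>)"
  have S: "q \<in> S \<longleftrightarrow> \<not> excess differentiable (at q)" for q
    by (simp add: S_def nondiff_points_def Lq_spectrum_differentiable_iff)
  have "z ` {1..N} \<subseteq> S" using z nondiff by (auto simp: S)
  moreover have "finite (z ` {1..N})" "card (z ` {1..N}) = N" using inj by (auto simp: card_image)
  moreover have "\<forall>q\<in>S. q < 0" using differentiable_nonneg S not_less by metis
  moreover have "2 \<le> 2 * m" using m2 by simp
  ultimately show ?thesis
    using admissible unfolding S_def by blast
qed

end
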